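(* Let $k \geq 1$ be an integer and let $\mathcal{H}^\infty = \bigcup_{n\ge 1}\mathcal{H}^\infty_n$ be a Hall set on the free Lie algebra of countably infinite rank. Define $$F_k := \sum_{X \in \mathcal{H}^{\infty}_k} \eta(X) \qquad\text{and}\qquad f_k := \sum_{i=0}^{\infty} (-1)^i e_i[F_k].$$ Then, for all integers $r \geq 2$, $$\Phi_r(f_k) = f_{r,k},$$ where $f_{r,k} := \prod_{X \in \mathcal{H}_k} (1 - \eta(X)) \in \mathbb{Z}[x_1,\ldots,x_r]$ for a Hall basis $\mathcal{H} = \bigcup_{n \geq 1} \mathcal{H}_n$ of the free Lie algebra of rank $r$.
   Context: Hall bases and Hall sets. Let $\mathfrak{f}_r$ be the free complex Lie algebra on $X_1,\ldots,X_r$. A Hall basis of $\mathfrak{f}_r$ is a totally ordered set $\mathcal{H} = \bigcup_{n\ge1}\mathcal{H}_n$ (it is a vector space basis of $\mathfrak{f}_r$) constructed inductively: - $\mathcal{H}_1 := \{X_1,\ldots,X_r\}$ with $X_1 < \cdots < X_r$. - For $n\ge 2$, given $\mathcal{H}_1,\ldots,\mathcal{H}_{n-1}$ and a total order on their union, $\mathcal{H}_n$ is the set of all Lie brackets $[Y,Z]$ with $Y \in \mathcal{H}_a$, $Z \in \mathcal{H}_b$ such that $a+b=n$, $Y<Z$, and, if $Z = [Z_1,Z_2]$ is itself a bracket of the construction (with each $Z_i$ in some $\mathcal{H}_{k_i}$), then $Z_1 \leq Y$. - The order is extended by choosing any total order on $\mathcal{H}_n$ and declaring every element of $\mathcal{H}_j$,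 $j<n$, to be smaller than every element of $\mathcal{H}_n$. A Hall set $\mathcal{H}^\infty = \bigcup_{n\ge1}\mathcal{H}^\infty_n$ on the free complex Lie algebra $\mathfrak{f}_\infty$ on $X_1, X_2, \ldots$ is constructed by exactly the same rules starting from $\mathcal{H}^\infty_1 := \{X_1,X_2,\ldots\}$ with $X_1<X_2<\cdots$. The map $\eta$ (from $\mathcal{H}$, respectively $\mathcal{H}^\infty$, to monomials in the $x_i$) is defined inductively by $\eta(X_i) := x_i$ and $\eta([Y,Z]) := \eta(Y)\eta(Z)$. The multiset $\{\eta(X) \mid X \in \mathcal{H}_k\}$ does not depend on the choice of the Hall basis $\mathcal{H}$ of $\mathfrak{f}_r$. Symmetric functions. $\mathbb{Z}[[x_1,x_2,\ldots]]$ is the ring of all formal sums $\sum_{\alpha} c_\alpha x^\alpha$, $c_\alpha\in\mathbb{Z}$, over sequences $\alpha = (\alpha_i)_{i\ge1}$ of non-negative integers with finite support, where $x^\alpha = \prod_i x_i^{\alpha_i}$. A symmetric function is such a series whose coefficients are invariant under all permutations of the variables (unbounded degree is allowed). For an integer $r\ge1$, $\Phi_r$ sends $\sum_\alpha c_\alpha x^\alpha$ to the sum of those terms $c_\alpha x^\alpha$ with $\mathrm{supp}(\alpha)\subseteq\{1,\ldots,r\}$. The elementary symmetric functions are $e_i := \sum_{j_1<\cdots<j_i} x_{j_1}\cdots x_{j_i}$, with $e_0 = 1$. If $f$ is a symmetric function and $g = \sum_{i\ge1} x^{\alpha_i}$ is a symmetric function written as a sum of monomials (a monomial may be repeated), the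 plethysm is $f[g] := f(x^{\alpha_1},x^{\alpha_2},\ldots)$. *)

theory Defs
  imports Complex_Main "HOL-Library.Poly_Mapping"
begin

section \<open>Free complex Lie algebras\<close>

text \<open>
  The free complex Lie algebra on a type of generators: formal Lie expressions modulo the least
  congruence that contains the axioms of complex vector spaces and of Lie brackets.
\<close>

datatype 'a lie_term =
    Gen 'a
  | Zero
  | Add "'a lie_term" "'a lie_term"
  | Scale complex "'a lie_term"
  | Brk "'a lie_term" "'a lie_term"

inductive lie_eq :: "'a lie_term \<Rightarrow> 'a lie_term \<Rightarrow> bool" where
  lie_refl: "lie_eq s s"
| lie_sym: "lie_eq s t \<Longrightarrow> lie_eq t s"
| lie_trans: "lie_eq s t \<Longrightarrow> lie_eq t u \<Longrightarrow> lie_eq s u"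
| lie_cong_Add: "lie_eq s s' \<Longrightarrow> lie_eq t t' \<Longrightarrow> lie_eq (Add s t) (Add s' t')"
| lie_cong_Scale: "lie_eq s s' \<Longrightarrow> lie_eq (Scale c s) (Scale c s')"
| lie_cong_Brk: "lie_eq s s' \<Longrightarrow> lie_eq t t' \<Longrightarrow> lie_eq (Brk s t) (Brk s' t')"
| lie_add_assoc: "lie_eq (Add (Add s t) u) (Add s (Add t u))"
| lie_add_comm: "lie_eq (Add s t) (Add t s)"
| lie_add_zero: "lie_eq (Add Zero s) s"
| lie_add_inv: "lie_eq (Add (Scale (- 1) s) s) Zero"
| lie_scale_one: "lie_eq (Scale 1 s) s"
| lie_scale_scale: "lie_eq (Scale c (Scale d s)) (Scale (c * d) s)"
| lie_scale_add: "lie_eq (Scale c (Add s t)) (Add (Scale c s) (Scale c t))"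
| lie_add_scale: "lie_eq (Scale (c + d) s) (Add (Scale c s) (Scale d s))"
| lie_brk_add_left: "lie_eq (Brk (Add s t) u) (Add (Brk s u) (Brk t u))"
| lie_brk_add_right: "lie_eq (Brk s (Add t u)) (Add (Brk s t) (Brk s u))"
| lie_brk_scale_left: "lie_eq (Brk (Scale c s) t) (Scale c (Brk s t))"
| lie_brk_scale_right: "lie_eq (Brk s (Scale c t)) (Scale c (Brk s t))"
| lie_brk_alternating: "lie_eq (Brk s s) Zero"
| lie_brk_jacobi: "lie_eq (Add (Brk s (Brk t u)) (Add (Brk t (Brk u s)) (Brk u (Brk s t)))) Zero"

quotient_type 'a free_lie = "'a lie_term" / lie_eq
  by (intro equivpI reflpI sympI transpI) (rule lie_refl, erule lie_sym, erule (1) lie_trans)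

lift_definition gen :: "'a \<Rightarrow> 'a free_lie" is Gen .

lift_definition bracket :: "'a free_lie \<Rightarrow> 'a free_lie \<Rightarrow> 'a free_lie" is Brk
  by (rule lie_cong_Brk)

lift_definition lie_scale :: "complex \<Rightarrow> 'a free_lie \<Rightarrow> 'a free_lie" is Scale
  by (rule lie_cong_Scale)

instantiation free_lie :: (type) ab_group_add
begin

lift_definition zero_free_lie :: "'a free_lie" is Zero .

lift_definition plus_free_lie :: "'a free_lie \<Rightarrow> 'a free_lie \<Rightarrow> 'a free_lie" is Add
  by (rule lie_cong_Add)

lift_definition uminus_free_lie :: "'a free_lie \<Rightarrow> 'a free_lie" is "Scale (- 1)"
  by (rule lie_cong_Scale)

definition minus_free_lie :: "'a free_lie \<Rightarrow> 'a free_lie \<Rightarrow> 'a free_lie" where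
  "minus_free_lie x y = x + (- y)"

instance
proof
  fix x y z :: "'a free_lie"
  show "x + y + z = x + (y + z)"
    by transfer (rule lie_add_assoc)
  show "x + y = y + x"
    by transfer (rule lie_add_comm)
  show "0 + x = x"
    by transfer (rule lie_add_zero)
  show "- x + x = 0"
    by transfer (rule lie_add_inv)
  show "x - y = x + - y"
    by (rule minus_free_lie_def)
qed

end

lemma vector_space_lie_scale: "vector_space lie_scale"
proof
  fix c d and x y :: "'a free_lie"
  show "lie_scale c (x + y) = lie_scale c x + lie_scale c y"
    by transfer (rule lie_scale_add)
  show "lie_scale (c + d) x = lie_scale c x + lie_scale d x"
    by transfer (rule lie_add_scale)
  show "lie_scale c (lie_scale d x) = lie_scale (c * d) x"
    by transfer (rule lie_scale_scale)
  show "lie_scale 1 x = x"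
    by transfer (rule lie_scale_one)
qed

lemma lie_brackets:
  "bracket (x + y) z = bracket x z + bracket y z"
  "bracket x (y + z) = bracket x y + bracket x z"
  "bracket (lie_scale c x) y = lie_scale c (bracket x y)"
  "bracket x (lie_scale c y) = lie_scale c (bracket x y)"
  "bracket x x = 0"
  "bracket x (bracket y z) + (bracket y (bracket z x) + bracket z (bracket x y)) = 0"
  by (transfer, rule lie_brk_add_left lie_brk_add_right lie_brk_scale_left lie_brk_scale_right lie_brk_alternating
    lie_brk_jacobi)+


section \<open>Hall bases and Hall sets\<close>

text \<open>
  Indices are shifted by one: the generator \<open>gen i\<close> is $X_{i+1}$ and the variable with index
  \<open>i\<close> is $x_{i+1}$.  The type \<^typ>\<open>nat free_lie\<close> is the free Lie algebra of countably infinite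
  rank.  The free Lie algebra of rank $r$ is its Lie subalgebra generated by the \<open>gen i\<close> with
  \<open>i < r\<close>: sending the other generators to 0 is a retraction onto that subalgebra, which is
  therefore free on these generators.

  A Hall set is a family \<open>H\<close>, of which only the \<open>H n\<close> with \<open>n \<ge> 1\<close> matter, together with a
  total order \<open>le\<close> on the union of these; the strict order is \<open>le - Id\<close>.
\<close>

text \<open>
  The pairs \<open>(Y, Z)\<close> whose bracket is put into \<open>H n\<close>.  The last condition ranges over the pairs
  from which \<open>Z\<close> itself was constructed, not over all ways to write \<open>Z\<close> as a bracket of two
  elements of the Hall set.  There are no such pairs if \<open>Z\<close> has degree 1.
\<close>

function hall_pairs ::
  "(nat \<Rightarrow> nat free_lie set) \<Rightarrow> nat free_lie rel \<Rightarrow> nat \<Rightarrow> nat free_lie rel" where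
  "hall_pairs H le n = (\<Union>b\<in>{1..<n}. {(Y, Z). Y \<in> H (n - b) \<and> Z \<in> H b \<and> (Y, Z) \<in> le - Id \<and>
     (\<forall>(Z1, Z2) \<in> hall_pairs H le b. Z = bracket Z1 Z2 \<longrightarrow> (Z1, Y) \<in> le)})"
  by auto
termination
  by (relation "measure (\<lambda>(H, le, n). n)") auto

declare hall_pairs.simps [simp del]

text \<open>
  For \<open>I = UNIV\<close> this is a Hall set in the free Lie algebra of infinite rank, and for
  \<open>I = {..<r}\<close> it is a Hall basis of the free Lie algebra of rank $r$.
\<close>

definition hall_set ::
  "nat set \<Rightarrow> (nat \<Rightarrow> nat free_lie set) \<Rightarrow> nat free_lie rel \<Rightarrow> bool" where
  "hall_set I H le \<longleftrightarrow>
     linear_order_on (\<Union>n\<in>{1..}. H n) le \<and>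
     H 1 = gen ` I \<and>
     (\<forall>i\<in>I. \<forall>j\<in>I. i < j \<longrightarrow> (gen i, gen j) \<in> le - Id) \<and>
     (\<forall>n\<ge>2. H n = (\<lambda>(Y, Z). bracket Y Z) ` hall_pairs H le n) \<and>
     (\<forall>n. \<forall>j\<in>{1..<n}. H j \<times> H n \<subseteq> le - Id)"

text \<open>
  Monomials are exponent vectors of type \<^typ>\<open>nat \<Rightarrow>\<^sub>0 nat\<close>, so that \<open>+\<close> is the product of
  monomials.  The map $\eta$ is defined along the construction of the Hall set.
\<close>

inductive eta_rel ::
  "(nat \<Rightarrow> nat free_lie set) \<Rightarrow> nat free_lie rel \<Rightarrow> nat free_lie \<Rightarrow> (nat \<Rightarrow>\<^sub>0 nat) \<Rightarrow> bool"
  for H le where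
  "gen i \<in> H 1 \<Longrightarrow> eta_rel H le (gen i) (Poly_Mapping.single i 1)"
| "(Y, Z) \<in> hall_pairs H le n \<Longrightarrow> eta_rel H le Y p \<Longrightarrow> eta_rel H le Z q \<Longrightarrow>
     eta_rel H le (bracket Y Z) (p + q)"

definition eta ::
  "(nat \<Rightarrow> nat free_lie set) \<Rightarrow> nat free_lie rel \<Rightarrow> nat free_lie \<Rightarrow> (nat \<Rightarrow>\<^sub>0 nat)" where
  "eta H le X = (THE p. eta_rel H le X p)"


section \<open>Formal series and symmetric functions\<close>

text \<open>
  A formal series in $x_1, x_2, \ldots$ with integer coefficients is the function that gives its
  coefficients; a polynomial is an element of the ring \<^typ>\<open>(nat \<Rightarrow>\<^sub>0 nat) \<Rightarrow>\<^sub>0 int\<close>.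
\<close>

type_synonym series = "(nat \<Rightarrow>\<^sub>0 nat) \<Rightarrow> int"

text \<open>
  The formal sum of the monomials \<open>f a\<close> for \<open>a \<in> A\<close>, which makes sense if every monomial is
  taken only finitely often.
\<close>

definition monomial_sum :: "('b \<Rightarrow> (nat \<Rightarrow>\<^sub>0 nat)) \<Rightarrow> 'b set \<Rightarrow> series" where
  "monomial_sum f A = (\<lambda>m. int (card {a \<in> A. f a = m}))"

definition elem_sym :: "nat \<Rightarrow> series" where
  "elem_sym i = monomial_sum (\<lambda>J. \<Sum>j\<in>J. Poly_Mapping.single j 1) {J. finite J \<and> card J = i}"

text \<open>The monomial obtained from the monomial \<open>b\<close> by replacing each $x_{i+1}$ by \<open>a i\<close>.\<close>

definition subst_monomial :: "(nat \<Rightarrow> (nat \<Rightarrow>\<^sub>0 nat)) \<Rightarrow> (nat \<Rightarrow>\<^sub>0 nat) \<Rightarrow> (nat \<Rightarrow>\<^sub>0 nat)" where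
  "subst_monomial a b =
     (\<Sum>i\<in>Poly_Mapping.keys b. Poly_Mapping.map (\<lambda>e. Poly_Mapping.lookup b i * e) (a i))"

definition subst_series :: "(nat \<Rightarrow> (nat \<Rightarrow>\<^sub>0 nat)) \<Rightarrow> series \<Rightarrow> series" where
  "subst_series a f = (\<lambda>m. \<Sum>b | f b \<noteq> 0 \<and> subst_monomial a b = m. f b)"

text \<open>
  Plethysm $f[g]$ of symmetric functions, where \<open>g\<close> is a sum of monomials.  As \<open>f\<close> is symmetric,
  it does not matter in which order the monomials of \<open>g\<close> are enumerated.
\<close>

definition enumerates_monomials :: "(nat \<Rightarrow> (nat \<Rightarrow>\<^sub>0 nat)) \<Rightarrow> series \<Rightarrow> bool" where
  "enumerates_monomials a g \<longleftrightarrow> (\<forall>m. finite {i. a i = m}) \<and> g = monomial_sum a UNIV"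

definition plethysm :: "series \<Rightarrow> series \<Rightarrow> series" where
  "plethysm f g = subst_series (SOME a. enumerates_monomials a g) f"

definition Phi :: "nat \<Rightarrow> series \<Rightarrow> series" where
  "Phi r f = (\<lambda>m. if Poly_Mapping.keys m \<subseteq> {..<r} then f m else 0)"


section \<open>The series $F_k$, $f_k$ and the polynomial $f_{r,k}$\<close>

definition hall_F :: "(nat \<Rightarrow> nat free_lie set) \<Rightarrow> nat free_lie rel \<Rightarrow> nat \<Rightarrow> series" where
  "hall_F H le k = monomial_sum (eta H le) (H k)"

text \<open>
  The infinite sum over \<open>i\<close> is taken coefficient by coefficient, and each coefficient is a sum
  with finitely many nonzero terms.
\<close>

definition hall_f :: "(nat \<Rightarrow> nat free_lie set) \<Rightarrow> nat free_lie rel \<Rightarrow> nat \<Rightarrow> series" where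
  "hall_f H le k = (\<lambda>m. Sum_any (\<lambda>i. (- 1) ^ i * plethysm (elem_sym i) (hall_F H le k) m))"

definition hall_poly ::
  "(nat \<Rightarrow> nat free_lie set) \<Rightarrow> nat free_lie rel \<Rightarrow> nat \<Rightarrow> (nat \<Rightarrow>\<^sub>0 nat) \<Rightarrow>\<^sub>0 int" where
  "hall_poly H le k = (\<Prod>X\<in>H k. 1 - Poly_Mapping.single (eta H le X) 1)"

end

theory Submission
  imports Defs "HOL-Library.Multiset" "HOL-Library.Countable_Set"
begin

text \<open>
  Lazard elimination: if $A$ freely generates an associative algebra and $y \in A$, then the
  iterated commutators $[y, [y, \ldots [y, a]]]$ with $a \in A \setminus \{y\}$ are again free
  generators of a subalgebra, and every word in $A$ corresponds to a word in these new letters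
  together with a power of $y$.  Eliminate the Hall trees of degree less than $n$ in increasing
  order.  The Hall trees of degree $n$ are among the remaining letters, so their values are
  distinct.  Moreover, the words of a given multidegree $m$ of total degree $n$ correspond to the
  Hall trees of multidegree $m$ and to the multisets of multidegree $m$ of Hall trees of smaller
  degree.  By induction the number of Hall trees of multidegree $m$ is thus independent of the
  Hall order and of the rank.  Hence the monomials of $F_k$ in $x_1, \ldots, x_r$ are the $\eta(X)$
  with $X \in \mathcal{H}_k$, with the same multiplicities, and expanding the product
  $f_{r,k}$ gives the claim.
\<close>

section \<open>Free associative algebras\<close>

text \<open>The product of \<open>poly_mapping\<close> adds the indices, so concatenation as
  addition of lists turns the finitely supported functions on words into the free associative
  algebra.\<close>

instantiation list :: (type) monoid_add
begin

definition zero_list :: "'a list" where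
  "zero_list = []"

definition plus_list :: "'a list \<Rightarrow> 'a list \<Rightarrow> 'a list" where
  "plus_list u v = u @ v"

instance
  by standard (simp_all add: zero_list_def plus_list_def)

end

type_synonym 'a free_alg = "'a list \<Rightarrow>\<^sub>0 complex"

text \<open>Scalars act by multiplication with multiples of the unit; \<open>const_commute\<close>
  shows that these are central.\<close>

abbreviation const :: "complex \<Rightarrow> 'a free_alg" where
  "const c \<equiv> Poly_Mapping.single 0 c"

abbreviation word :: "'a list \<Rightarrow> 'a free_alg" where
  "word w \<equiv> Poly_Mapping.single w 1"

lemma word_Nil: "word [] = 1"
  by (metis single_one zero_list_def)

lemma word_append: "word (u @ v) = word u * word v"
  by (simp add: mult_single plus_list_def)

lemma word_Cons: "word (a # w) = word [a] * word w"
  using word_append[of "[a]" w] by simp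

lemma const_mult_word: "const c * word w = Poly_Mapping.single w c"
  by (simp add: mult_single)

lemma sum_const_mult_word:
  "f = (\<Sum>w\<in>Poly_Mapping.keys f. const (Poly_Mapping.lookup f w) * word w)"
  by (rule poly_mapping_eqI)
    (simp add: const_mult_word lookup_sum lookup_single when_def in_keys_iff)

lemma free_alg_induct [case_names zero word add]:
  assumes "P 0" and "\<And>c w. P (const c * word w)" and "\<And>f g. P f \<Longrightarrow> P g \<Longrightarrow> P (f + g)"
  shows "P f"
proof -
  have "P (\<Sum>w\<in>A. const (Poly_Mapping.lookup f w) * word w)" for A
    by (induction A rule: infinite_finite_induct) (simp_all add: assms)
  then show ?thesis
    using sum_const_mult_word[of f] by metis
qed

lemma const_commute: "const c * f = f * const c"
proof (induction f rule: free_alg_induct)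
  case (word d w)
  show ?case
    by (simp add: mult_single mult.commute)
qed (simp_all add: distrib_left distrib_right)

section \<open>Linear extension of maps on words and substitution of letters\<close>

definition lin_ext :: "('a list \<Rightarrow> 'b free_alg) \<Rightarrow> 'a free_alg \<Rightarrow> 'b free_alg" where
  "lin_ext \<phi> f = (\<Sum>w\<in>Poly_Mapping.keys f. const (Poly_Mapping.lookup f w) * \<phi> w)"

text \<open>Terms may cancel in \<open>f + g\<close>, so additivity is proved by expanding
  \<open>f\<close>, \<open>g\<close> and \<open>f + g\<close> over one common finite set of
  words.\<close>

lemma lin_ext_superset:
  assumes "finite S" and "Poly_Mapping.keys f \<subseteq> S"
  shows "lin_ext \<phi> f = (\<Sum>w\<in>S. const (Poly_Mapping.lookup f w) * \<phi> w)"
  unfolding lin_ext_def using assms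
  by (intro sum.mono_neutral_left) (auto simp: in_keys_iff)

lemma lin_ext_zero [simp]: "lin_ext \<phi> 0 = 0"
  by (simp add: lin_ext_def)

lemma lin_ext_add [simp]: "lin_ext \<phi> (f + g) = lin_ext \<phi> f + lin_ext \<phi> g"
proof -
  let ?S = "Poly_Mapping.keys f \<union> Poly_Mapping.keys g"
  show ?thesis
    using lin_ext_superset[of ?S f \<phi>] lin_ext_superset[of ?S g \<phi>]
      lin_ext_superset[of ?S "f + g" \<phi>] keys_add[of f g]
    by (simp add: lookup_add single_add distrib_right sum.distrib)
qed

lemma lin_ext_single: "lin_ext \<phi> (Poly_Mapping.single w c) = const c * \<phi> w"
  by (simp add: lin_ext_def)

lemma lin_ext_word [simp]: "lin_ext \<phi> (word w) = \<phi> w"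
  by (simp add: lin_ext_single)

lemma lin_ext_const [simp]: "lin_ext \<phi> (const c * f) = const c * lin_ext \<phi> f"
proof (induction f rule: free_alg_induct)
  case (word d w)
  have "const c * (const d * word w) = Poly_Mapping.single w (c * d)"
    by (simp add: mult_single)
  then show ?case
    by (simp add: lin_ext_single const_mult_word mult_single flip: mult.assoc)
qed (simp_all add: distrib_left)

lemma lin_ext_uminus [simp]: "lin_ext \<phi> (- f) = - lin_ext \<phi> f"
  using lin_ext_const[of \<phi> "-1" f] by (simp add: single_uminus)

lemma lin_ext_diff [simp]: "lin_ext \<phi> (f - g) = lin_ext \<phi> f - lin_ext \<phi> g"
  using lin_ext_add[of \<phi> f "- g"] by simp

lemma lin_ext_word_id: "lin_ext word f = f"
  using sum_const_mult_word[of f] by (simp add: lin_ext_def)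

lemma lin_ext_cong:
  "(\<And>w. w \<in> Poly_Mapping.keys f \<Longrightarrow> \<phi> w = \<psi> w) \<Longrightarrow> lin_ext \<phi> f = lin_ext \<psi> f"
  by (simp add: lin_ext_def)

lemma lin_ext_comp:
  assumes "\<And>f g. L (f + g) = L f + L g" and "\<And>c f. L (const c * f) = const c * L f"
  shows "L (lin_ext \<phi> f) = lin_ext (\<lambda>w. L (\<phi> w)) f"
proof (induction f rule: free_alg_induct)
  case zero
  have "L 0 = 0"
    using assms(1)[of 0 0] by simp
  then show ?case
    by simp
qed (simp_all add: assms)

definition alg_hom :: "('a \<Rightarrow> 'b free_alg) \<Rightarrow> 'a free_alg \<Rightarrow> 'b free_alg" where
  "alg_hom \<phi> = lin_ext (\<lambda>w. prod_list (map \<phi> w))"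

lemma alg_hom_simps [simp]:
  "alg_hom \<phi> (f + g) = alg_hom \<phi> f + alg_hom \<phi> g"
  "alg_hom \<phi> (f - g) = alg_hom \<phi> f - alg_hom \<phi> g"
  "alg_hom \<phi> (const c * f) = const c * alg_hom \<phi> f"
  "alg_hom \<phi> (word w) = prod_list (map \<phi> w)"
  by (simp_all add: alg_hom_def)

lemma alg_hom_mult [simp]: "alg_hom \<phi> (f * g) = alg_hom \<phi> f * alg_hom \<phi> g"
proof (induction f rule: free_alg_induct)
  case (word c w)
  have "alg_hom \<phi> (word w * g) = alg_hom \<phi> (word w) * alg_hom \<phi> g" for w
  proof (induction g rule: free_alg_induct)
    case (word d v)
    have "word w * (const d * word v) = const d * word (w @ v)"
      by (metis const_commute mult.assoc word_append)
    then have "alg_hom \<phi> (word w * (const d * word v))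
        = const d * (prod_list (map \<phi> w) * prod_list (map \<phi> v))"
      by simp
    then show ?case
      by (metis alg_hom_simps(3,4) const_commute mult.assoc)
  qed (simp_all add: distrib_left alg_hom_def)
  then show ?case
    by (simp add: mult.assoc del: alg_hom_simps(4))
qed (simp_all add: distrib_right alg_hom_def)

lemma alg_hom_prod_list: "alg_hom \<phi> (prod_list fs) = prod_list (map (alg_hom \<phi>) fs)"
proof (induction fs)
  case Nil
  show ?case
    using alg_hom_simps(4)[of \<phi> "[]"] by (simp add: word_Nil)
qed simp

lemma alg_hom_alg_hom: "alg_hom \<phi> (alg_hom \<psi> f) = alg_hom (\<lambda>a. alg_hom \<phi> (\<psi> a)) f"
  unfolding alg_hom_def[of \<psi>] alg_hom_def[of "\<lambda>a. alg_hom \<phi> (\<psi> a)"]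
  by (subst lin_ext_comp) (simp_all add: alg_hom_prod_list o_def del: alg_hom_mult)

text \<open>The free algebra on \<open>A\<close> is kept inside the free algebra on the whole type,
  so that all alphabets that occur during the elimination share one type.\<close>

definition words_in :: "'a set \<Rightarrow> 'a free_alg set" where
  "words_in A = {f. Poly_Mapping.keys f \<subseteq> lists A}"

lemma words_in_word: "w \<in> lists A \<Longrightarrow> word w \<in> words_in A"
  by (simp add: words_in_def)

lemma words_in_zero: "0 \<in> words_in A"
  by (simp add: words_in_def)

lemma words_in_add: "f \<in> words_in A \<Longrightarrow> g \<in> words_in A \<Longrightarrow> f + g \<in> words_in A"
  using keys_add[of f g] unfolding words_in_def by blast

lemma words_in_diff: "f \<in> words_in A \<Longrightarrow> g \<in> words_in A \<Longrightarrow> f - g \<in> words_in A"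
  using keys_diff[of f g] unfolding words_in_def by blast

lemma words_in_mult: "f \<in> words_in A \<Longrightarrow> g \<in> words_in A \<Longrightarrow> f * g \<in> words_in A"
  using keys_mult[of f g] unfolding words_in_def plus_list_def by fastforce

lemma words_in_const: "const c \<in> words_in A"
  by (simp add: words_in_def zero_list_def)

lemma words_in_alg_hom:
  assumes "f \<in> words_in A" and "\<And>a. a \<in> A \<Longrightarrow> \<phi> a \<in> words_in B"
  shows "alg_hom \<phi> f \<in> words_in B"
proof -
  have "prod_list (map \<phi> w) \<in> words_in B" if "w \<in> lists A" for w
    using that
  proof (induction w)
    case Nil
    show ?case
      using words_in_word[of "[]" B] by (simp add: word_Nil)
  qed (simp add: assms(2) words_in_mult)
  moreover have "sum \<psi> S \<in> words_in B" if "\<And>w. w \<in> S \<Longrightarrow> \<psi> w \<in> words_in B"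
    for \<psi> :: "'a list \<Rightarrow> 'b free_alg" and S
    using that
    by (induction S rule: infinite_finite_induct) (simp_all add: words_in_zero words_in_add)
  ultimately show ?thesis
    using assms(1) unfolding alg_hom_def lin_ext_def words_in_def[of A]
    by (simp add: subset_iff words_in_mult words_in_const)
qed

section \<open>Evaluation of trees\<close>

text \<open>A tree remembers how an iterated bracket is formed, which its value in the free Lie
  algebra does not. Trees also serve as the letters of the alphabets below.\<close>

datatype tree = Leaf nat | Node tree tree

fun deg :: "tree \<Rightarrow> nat" where
  "deg (Leaf i) = 1"
| "deg (Node s t) = deg s + deg t"

fun mdeg :: "tree \<Rightarrow> nat \<Rightarrow>\<^sub>0 nat" where
  "mdeg (Leaf i) = Poly_Mapping.single i 1"
| "mdeg (Node s t) = mdeg s + mdeg t"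

fun leaves :: "tree \<Rightarrow> nat set" where
  "leaves (Leaf i) = {i}"
| "leaves (Node s t) = leaves s \<union> leaves t"

fun lie_val :: "tree \<Rightarrow> nat free_lie" where
  "lie_val (Leaf i) = gen i"
| "lie_val (Node s t) = bracket (lie_val s) (lie_val t)"

text \<open>The values are combinations of words in leaves, kept inside the words in trees. Thus
  \<open>alg_hom alg_val\<close> maps the algebra on trees to itself and fixes the words in
  leaves.\<close>

fun alg_val :: "tree \<Rightarrow> tree free_alg" where
  "alg_val (Leaf i) = word [Leaf i]"
| "alg_val (Node s t) = alg_val s * alg_val t - alg_val t * alg_val s"

fun term_alg :: "nat lie_term \<Rightarrow> tree free_alg" where
  "term_alg (Gen i) = word [Leaf i]"
| "term_alg Zero = 0"
| "term_alg (Add s t) = term_alg s + term_alg t"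
| "term_alg (Scale c s) = const c * term_alg s"
| "term_alg (Brk s t) = term_alg s * term_alg t - term_alg t * term_alg s"

text \<open>Commutators in an associative algebra satisfy the Lie axioms. Hence
  \<open>lie_alg\<close> is well defined, and Lie elements can be told apart by their images under
  it.\<close>

lemma term_alg_cong: "lie_eq s t \<Longrightarrow> term_alg s = term_alg t"
proof (induction rule: lie_eq.induct)
  case (lie_brk_scale_right s c t)
  have "term_alg s * (const c * term_alg t) = const c * (term_alg s * term_alg t)"
    by (metis const_commute mult.assoc)
  then show ?case
    by (simp add: algebra_simps)
next
  case (lie_brk_scale_left c s t)
  have "term_alg t * (const c * term_alg s) = const c * (term_alg t * term_alg s)"
    by (metis const_commute mult.assoc)
  then show ?case
    by (simp add: algebra_simps)
next
  case (lie_scale_scale c d s)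
  show ?case
    by (simp add: mult_single flip: mult.assoc)
qed (simp_all add: algebra_simps single_add single_uminus)

lift_definition lie_alg :: "nat free_lie \<Rightarrow> tree free_alg" is term_alg
  by (rule term_alg_cong)

lemma lie_alg_lie_val: "lie_alg (lie_val t) = alg_val t"
proof (induction t)
  case (Leaf i)
  show ?case
    by (simp add: gen.abs_eq lie_alg.abs_eq)
next
  case (Node s t)
  have "lie_alg (bracket x y) = lie_alg x * lie_alg y - lie_alg y * lie_alg x" for x y
    by transfer simp
  with Node show ?case
    by simp
qed

lemma gen_inj: "gen i = gen j \<Longrightarrow> i = j" for i j :: nat
proof -
  assume "gen i = gen j"
  then have "word [Leaf i] = word [Leaf j]"
    using lie_alg_lie_val[of "Leaf i"] lie_alg_lie_val[of "Leaf j"] by simp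
  then have "Poly_Mapping.keys (word [Leaf i]) = Poly_Mapping.keys (word [Leaf j])"
    by simp
  then show "i = j"
    by simp
qed

lemma deg_pos: "0 < deg t"
  by (induction t) simp_all

lemma finite_leaves: "finite (leaves t)"
  by (induction t) simp_all

lemma keys_add_nat:
  "Poly_Mapping.keys (p + q :: 'a \<Rightarrow>\<^sub>0 nat) = Poly_Mapping.keys p \<union> Poly_Mapping.keys q"
  by (auto simp: in_keys_iff lookup_add)

lemma keys_mdeg: "Poly_Mapping.keys (mdeg t) = leaves t"
  by (induction t) (simp_all add: keys_add_nat)

section \<open>Degrees and weights\<close>

definition total_degree :: "('a \<Rightarrow>\<^sub>0 nat) \<Rightarrow> nat" where
  "total_degree p = (\<Sum>i\<in>Poly_Mapping.keys p. Poly_Mapping.lookup p i)"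

lemma total_degree_zero [simp]: "total_degree 0 = 0"
  by (simp add: total_degree_def)

lemma total_degree_add [simp]: "total_degree (p + q) = total_degree p + total_degree q"
  unfolding total_degree_def by (rule setsum_keys_plus_distrib) simp_all

lemma total_degree_mdeg [simp]: "total_degree (mdeg t) = deg t"
proof (induction t)
  case (Leaf i)
  show ?case
    by (simp add: total_degree_def)
qed simp_all

lemma finite_trees: "finite J \<Longrightarrow> finite {t. leaves t \<subseteq> J \<and> deg t \<le> n}"
proof (induction n)
  case 0
  have "{t. leaves t \<subseteq> J \<and> deg t \<le> 0} = {}"
    using deg_pos by (metis (mono_tags, lifting) Collect_empty_eq leD)
  then show ?case
    by (metis finite.emptyI)
next
  case (Suc n)
  let ?S = "{t. leaves t \<subseteq> J \<and> deg t \<le> n}"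
  have "{t. leaves t \<subseteq> J \<and> deg t \<le> Suc n} \<subseteq> Leaf ` J \<union> case_prod Node ` (?S \<times> ?S)"
  proof
    fix t assume t: "t \<in> {t. leaves t \<subseteq> J \<and> deg t \<le> Suc n}"
    show "t \<in> Leaf ` J \<union> case_prod Node ` (?S \<times> ?S)"
    proof (cases t)
      case (Node u v)
      with t deg_pos[of u] deg_pos[of v] have "(u, v) \<in> ?S \<times> ?S"
        by auto
      then show ?thesis
        unfolding Node by blast
    qed (use t in auto)
  qed
  with Suc show ?case
    by (meson finite_SigmaI finite_UnI finite_imageI finite_subset)
qed

definition wt :: "tree list \<Rightarrow> nat \<Rightarrow>\<^sub>0 nat" where
  "wt w = sum_list (map mdeg w)"

lemma wt_simps [simp]: "wt [] = 0" "wt (t # w) = mdeg t + wt w" "wt (u @ v) = wt u + wt v"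
  by (simp_all add: wt_def)

definition mwt :: "tree multiset \<Rightarrow> nat \<Rightarrow>\<^sub>0 nat" where
  "mwt M = sum_mset (image_mset mdeg M)"

lemma mwt_simps [simp]:
  "mwt {#} = 0" "mwt (add_mset t M) = mdeg t + mwt M" "mwt (M + N) = mwt M + mwt N"
  by (simp_all add: mwt_def)

lemma deg_le_total_degree_mwt: "t \<in># M \<Longrightarrow> deg t \<le> total_degree (mwt M)"
  by (induction M) auto

section \<open>Elimination of a letter\<close>

text \<open>
  Lazard elimination: eliminating \<open>y\<close> from the alphabet \<open>A\<close> leaves the letters
  $[y, [y, \ldots [y, a]]]$ with $a \in A \setminus \{y\}$.
\<close>

inductive_set elim_letter :: "tree \<Rightarrow> tree set \<Rightarrow> tree set" for y A where
  keep: "a \<in> A \<Longrightarrow> a \<noteq> y \<Longrightarrow> a \<in> elim_letter y A"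
| brk: "b \<in> elim_letter y A \<Longrightarrow> Node y b \<in> elim_letter y A"

text \<open>If some bracket \<open>Node y b\<close> were a letter from the start, it could not be
  told apart from one formed by the elimination.\<close>

definition no_left :: "tree \<Rightarrow> tree set \<Rightarrow> bool" where
  "no_left y A \<longleftrightarrow> (\<forall>b. Node y b \<notin> A)"

fun unfold_letter :: "tree \<Rightarrow> tree \<Rightarrow> tree list" where
  "unfold_letter y (Leaf i) = [Leaf i]"
| "unfold_letter y (Node s b) = (if s = y then y # unfold_letter y b else [Node s b])"

text \<open>A word factors uniquely into blocks \<open>y ... y a\<close> with \<open>a\<close>
  different from \<open>y\<close>, followed by a power of \<open>y\<close>. Each block becomes the
  letter [y, ... [y, a]], and the number is the exponent of the final power.\<close>

fun fold_word :: "tree \<Rightarrow> tree list \<Rightarrow> tree list \<times> nat" where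
  "fold_word y [] = ([], 0)"
| "fold_word y (a # w) = (case fold_word y w of (u, n) \<Rightarrow>
     if a \<noteq> y then (a # u, n) else (case u of [] \<Rightarrow> ([], Suc n) | b # v \<Rightarrow> (Node y b # v, n)))"

fun unfold_word :: "tree \<Rightarrow> tree list \<times> nat \<Rightarrow> tree list" where
  "unfold_word y (u, n) = concat (map (unfold_letter y) u) @ replicate n y"

lemma Node_neq: "Node y b \<noteq> y"
proof
  assume "Node y b = y"
  then have "size (Node y b) = size y"
    by simp
  then show False
    by simp
qed

lemma unfold_letter_keep: "no_left y A \<Longrightarrow> a \<in> A \<Longrightarrow> unfold_letter y a = [a]"
  by (cases a) (auto simp: no_left_def)

lemma unfold_word_fold_word:
  "no_left y A \<Longrightarrow> w \<in> lists A \<Longrightarrow> unfold_word y (fold_word y w) = w"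
proof (induction w)
  case (Cons a w)
  obtain u n where un: "fold_word y w = (u, n)"
    by fastforce
  with Cons have w: "concat (map (unfold_letter y) u) @ replicate n y = w" and "a \<in> A"
    by auto
  with Cons.prems(1) un show ?case
    by (auto simp: unfold_letter_keep split: list.splits)
qed simp

lemma fold_word_in:
  "w \<in> lists A \<Longrightarrow> fst (fold_word y w) \<in> lists (elim_letter y A)"
proof (induction w)
  case (Cons a w)
  then show ?case
    by (auto split: prod.splits list.splits intro: elim_letter.intros)
qed simp

lemma fold_word_replicate: "fold_word y (replicate n y) = ([], n)"
  by (induction n) auto

lemma fold_word_unfold_letter:
  assumes "a \<in> elim_letter y A" and "no_left y A"
  shows "fold_word y (unfold_letter y a @ w) = (a # fst (fold_word y w), snd (fold_word y w))"
  using assms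
proof (induction rule: elim_letter.induct)
  case (keep a)
  then show ?case
    by (simp add: unfold_letter_keep case_prod_beta)
qed simp

lemma fold_word_unfold_word:
  assumes "no_left y A" and "u \<in> lists (elim_letter y A)"
  shows "fold_word y (unfold_word y (u, n)) = (u, n)"
  using assms(2)
  by (induction u) (simp_all add: fold_word_replicate fold_word_unfold_letter[OF _ assms(1)])

lemma unfold_letter_in:
  assumes "y \<in> A" and "no_left y A" and "a \<in> elim_letter y A"
  shows "unfold_letter y a \<in> lists A"
  using assms(3)
proof (induction rule: elim_letter.induct)
  case (keep a)
  then show ?case
    by (simp add: unfold_letter_keep[OF assms(2)])
qed (simp add: assms(1))

lemma unfold_word_in:
  assumes "y \<in> A" and "no_left y A" and "u \<in> lists (elim_letter y A)"
  shows "unfold_word y (u, n) \<in> lists A"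
  using assms(3) unfold_letter_in[OF assms(1,2)] assms(1) by (induction u) auto

section \<open>Elimination and the number of words of a given multidegree\<close>

lemma wt_unfold_letter: "wt (unfold_letter y a) = mdeg a"
  by (induction a) auto

lemma wt_unfold_word: "wt (unfold_word y (u, n)) = wt u + mwt (replicate_mset n y)"
proof -
  have "wt (replicate n y) = mwt (replicate_mset n y)"
    by (induction n) simp_all
  moreover have "wt (concat (map (unfold_letter y) u)) = wt u"
    by (induction u) (simp_all add: wt_unfold_letter)
  ultimately show ?thesis
    by simp
qed

text \<open>The multiset holds the powers of the letters that have been eliminated already, so these
  pairs stand for words in the original alphabet.\<close>

definition weighted_pairs :: "tree set \<Rightarrow> tree set \<Rightarrow> (nat \<Rightarrow>\<^sub>0 nat) \<Rightarrow> (tree list \<times> tree multiset) set"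
  where "weighted_pairs A E m = {(w, M). w \<in> lists A \<and> set_mset M \<subseteq> E \<and> wt w + mwt M = m}"

text \<open>The bijection splits off the final power of \<open>y\<close> from the folded word and
  puts it into the multiset. As \<open>y\<close> is not in \<open>E\<close>, the exponent is
  recovered as the multiplicity of \<open>y\<close>.\<close>

lemma card_weighted_pairs_elim:
  assumes "y \<in> A" and "no_left y A" and "y \<notin> E"
  shows "card (weighted_pairs A E m) = card (weighted_pairs (elim_letter y A) (insert y E) m)"
proof (rule bij_betw_same_card)
  let ?f = "\<lambda>(w, M). (fst (fold_word y w), M + replicate_mset (snd (fold_word y w)) y)"
  let ?g = "\<lambda>(u, M). (unfold_word y (u, count M y), filter_mset (\<lambda>t. t \<noteq> y) M)"
  have M: "filter_mset (\<lambda>t. t \<noteq> y) M + replicate_mset (count M y) y = M" for M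
    using multiset_partition[of M "\<lambda>t. t \<noteq> y"] by (simp add: filter_eq_replicate_mset)
  have rep: "filter_mset (\<lambda>t. t \<noteq> y) (replicate_mset n y) = {#}" for n
    by (induction n) simp_all
  have notin: "count M y = 0 \<and> filter_mset (\<lambda>t. t \<noteq> y) M = M" if "set_mset M \<subseteq> E" for M
    using that assms(3) by (auto simp: count_eq_zero_iff filter_mset_eq_conv)
  have unfold_fold: "unfold_word y (fst (fold_word y w), snd (fold_word y w)) = w" if "w \<in> lists A" for w
    using unfold_word_fold_word[OF assms(2) that] by (simp only: prod.collapse)
  show "bij_betw ?f (weighted_pairs A E m) (weighted_pairs (elim_letter y A) (insert y E) m)"
  proof (rule bij_betw_byWitness[of _ ?g])
    show "\<forall>p\<in>weighted_pairs A E m. ?g (?f p) = p"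
      using unfold_fold notin unfolding weighted_pairs_def
      by (auto simp del: unfold_word.simps simp: rep)
    show "\<forall>p\<in>weighted_pairs (elim_letter y A) (insert y E) m. ?f (?g p) = p"
      using fold_word_unfold_word[OF assms(2)] M unfolding weighted_pairs_def
      by (auto simp del: unfold_word.simps)
    show "?f ` weighted_pairs A E m \<subseteq> weighted_pairs (elim_letter y A) (insert y E) m"
    proof (rule image_subsetI, unfold split_paired_all)
      fix w M assume "(w, M) \<in> weighted_pairs A E m"
      then have w: "w \<in> lists A" and "set_mset M \<subseteq> E" and "wt w + mwt M = m"
        by (simp_all add: weighted_pairs_def)
      moreover have "wt w = wt (fst (fold_word y w)) + mwt (replicate_mset (snd (fold_word y w)) y)"
        using wt_unfold_word unfold_fold[OF w] by metis
      ultimately show "?f (w, M) \<in> weighted_pairs (elim_letter y A) (insert y E) m"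
        using fold_word_in[OF w, of y] by (auto simp: weighted_pairs_def ac_simps)
    qed
    show "?g ` weighted_pairs (elim_letter y A) (insert y E) m \<subseteq> weighted_pairs A E m"
    proof (rule image_subsetI, unfold split_paired_all)
      fix u M assume "(u, M) \<in> weighted_pairs (elim_letter y A) (insert y E) m"
      then have u: "u \<in> lists (elim_letter y A)" and "set_mset M \<subseteq> insert y E" and "wt u + mwt M = m"
        by (simp_all add: weighted_pairs_def)
      moreover have "mwt M = mwt (filter_mset (\<lambda>t. t \<noteq> y) M) + mwt (replicate_mset (count M y) y)"
        using mwt_simps(3) M by metis
      ultimately show "?g (u, M) \<in> weighted_pairs A E m"
        using unfold_word_in[OF assms(1,2) u]
        by (auto simp: weighted_pairs_def wt_unfold_word ac_simps simp del: unfold_word.simps)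
    qed
  qed
qed

section \<open>Freeness of the letters that remain after an elimination\<close>

fun letter_alg :: "tree \<Rightarrow> tree \<Rightarrow> tree free_alg" where
  "letter_alg y (Leaf i) = word [Leaf i]"
| "letter_alg y (Node s b) =
     (if s = y then word [y] * letter_alg y b - letter_alg y b * word [y] else word [Node s b])"

lemma letter_alg_keep: "no_left y A \<Longrightarrow> a \<in> A \<Longrightarrow> letter_alg y a = word [a]"
  by (cases a) (auto simp: no_left_def)

lemma letter_alg_in:
  assumes "y \<in> A" and "no_left y A" and "a \<in> elim_letter y A"
  shows "letter_alg y a \<in> words_in A"
  using assms(3)
proof (induction rule: elim_letter.induct)
  case (keep a)
  then show ?case
    by (simp add: letter_alg_keep[OF assms(2)] words_in_word)
next
  case (brk b)
  then show ?case
    using assms(1) by (simp add: words_in_mult words_in_diff words_in_word)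
qed

text \<open>\<open>letter_alg\<close> expands only the outer commutators with \<open>y\<close>;
  \<open>alg_val\<close> then expands everything that is left.\<close>

lemma alg_hom_letter_alg: "alg_hom alg_val (letter_alg y a) = alg_val a"
  by (induction a) auto

fun word_deriv :: "tree \<Rightarrow> tree list \<Rightarrow> tree free_alg" where
  "word_deriv y [] = 0"
| "word_deriv y (a # w) = word (Node y a # w) + word [a] * word_deriv y w"

text \<open>
  Let \<open>y\<close> act as the derivation \<open>word_deriv y\<close> and every other letter by left multiplication.
  Then the iterated commutator \<open>letter_alg y a\<close> acts as left multiplication by the single letter
  \<open>a\<close>, so that acting on \<open>1\<close> inverts the substitution \<open>letter_alg y\<close>.
\<close>

fun word_act :: "tree \<Rightarrow> tree list \<Rightarrow> tree free_alg" where
  "word_act y [] = 1"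
| "word_act y (a # w) =
     (if a = y then lin_ext (word_deriv y) (word_act y w) else word [a] * word_act y w)"

text \<open>This is the Leibniz rule for a product with a letter, whose derivative is the letter
  \<open>Node y a\<close>.\<close>

lemma deriv_letter:
  "lin_ext (word_deriv y) (word [a] * f) = word [Node y a] * f + word [a] * lin_ext (word_deriv y) f"
proof (induction f rule: free_alg_induct)
  case (word c w)
  have "word [a] * (const c * word w) = const c * word (a # w)"
    by (metis const_commute mult.assoc word_Cons)
  moreover have "x * (const c * g) = const c * (x * g)" for x g :: "tree free_alg"
    by (metis const_commute mult.assoc)
  ultimately show ?case
    by (simp add: distrib_left word_Cons[of "Node y a" w])
qed (simp_all add: distrib_left)

lemma act_letter:
  assumes "a \<noteq> y"
  shows "lin_ext (word_act y) (word [a] * f) = word [a] * lin_ext (word_act y) f"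
    and "lin_ext (word_act y) (word [y] * f) = lin_ext (word_deriv y) (lin_ext (word_act y) f)"
proof -
  have c: "x * (const c * g) = const c * (x * g)" for x g :: "tree free_alg" and c
    by (metis const_commute mult.assoc)
  show "lin_ext (word_act y) (word [a] * f) = word [a] * lin_ext (word_act y) f"
    by (induction f rule: free_alg_induct) (simp_all add: c assms distrib_left flip: word_Cons)
  show "lin_ext (word_act y) (word [y] * f) = lin_ext (word_deriv y) (lin_ext (word_act y) f)"
    by (induction f rule: free_alg_induct) (simp_all add: c distrib_left flip: word_Cons)
qed

text \<open>Write D for the derivation \<open>word_deriv y\<close> and g for the result of acting
  with \<open>f\<close>. By induction a letter [y, b] acts as D(b g) - b D(g), of which the Leibniz
  rule leaves [y, b] g.\<close>

lemma act_letter_alg: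
  assumes "no_left y A" and "a \<in> elim_letter y A"
  shows "lin_ext (word_act y) (letter_alg y a * f) = word [a] * lin_ext (word_act y) f"
  using assms(2)
proof (induction arbitrary: f rule: elim_letter.induct)
  case (keep a)
  then show ?case
    by (simp add: letter_alg_keep[OF assms(1)] act_letter)
next
  case (brk b)
  then show ?case
    by (simp add: left_diff_distrib mult.assoc act_letter(2)[OF Node_neq] deriv_letter)
qed

lemma act_alg_hom:
  assumes "no_left y A" and "f \<in> words_in (elim_letter y A)"
  shows "lin_ext (word_act y) (alg_hom (letter_alg y) f) = f"
proof -
  have "lin_ext (word_act y) (prod_list (map (letter_alg y) w)) = word w"
    if "w \<in> lists (elim_letter y A)" for w
    using that
  proof (induction w)
    case Nil
    show ?case
      using lin_ext_word[of "word_act y" "[]"] by (simp add: word_Nil)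
  next
    case (Cons a w)
    then show ?case
      by (simp add: act_letter_alg[OF assms(1)] word_Cons[of a w])
  qed
  then have act: "lin_ext (word_act y) (prod_list (map (letter_alg y) w)) = word w"
    if "w \<in> Poly_Mapping.keys f" for w
    using that assms(2) unfolding words_in_def by blast
  have "lin_ext (word_act y) (alg_hom (letter_alg y) f)
      = lin_ext (\<lambda>w. lin_ext (word_act y) (prod_list (map (letter_alg y) w))) f"
    unfolding alg_hom_def by (rule lin_ext_comp) simp_all
  also have "\<dots> = lin_ext word f"
    by (rule lin_ext_cong) (rule act)
  finally show ?thesis
    by (simp only: lin_ext_word_id)
qed

text \<open>The values of the letters are free generators of the associative algebra that they
  generate.\<close>

definition free_letters :: "tree set \<Rightarrow> bool" where
  "free_letters A \<longleftrightarrow> (\<forall>f\<in>words_in A. alg_hom alg_val f = 0 \<longrightarrow> f = 0)"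

text \<open>Evaluating the new letters amounts to the substitution \<open>letter_alg\<close>
  followed by the evaluation of the old letters. The former has a left inverse by
  \<open>act_alg_hom\<close>, and the latter has trivial kernel by assumption.\<close>

lemma free_letters_elim:
  assumes "y \<in> A" and "no_left y A" and "free_letters A"
  shows "free_letters (elim_letter y A)"
  unfolding free_letters_def
proof safe
  fix f assume f: "f \<in> words_in (elim_letter y A)" and 0: "alg_hom alg_val f = 0"
  let ?h = "alg_hom (letter_alg y) f"
  have "alg_hom alg_val ?h = 0"
    using 0 by (simp add: alg_hom_alg_hom alg_hom_letter_alg)
  moreover have "?h \<in> words_in A"
    using f letter_alg_in[OF assms(1,2)] by (rule words_in_alg_hom)
  ultimately have "?h = 0"
    using assms(3) by (simp add: free_letters_def)
  then show "f = 0"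
    using act_alg_hom[OF assms(2) f] by simp
qed

lemma free_letters_inj:
  assumes "free_letters A" and "a \<in> A" and "b \<in> A" and "alg_val a = alg_val b"
  shows "a = b"
proof -
  have "word [a] - word [b] \<in> words_in A"
    using assms(2,3) by (intro words_in_diff words_in_word) simp_all
  moreover have "alg_hom alg_val (word [a] - word [b]) = 0"
    using assms(4) by simp
  ultimately have "word [a] = word [b]"
    using assms(1) by (auto simp: free_letters_def)
  then have "Poly_Mapping.keys (word [a]) = Poly_Mapping.keys (word [b])"
    by simp
  then show ?thesis
    by simp
qed

lemma free_letters_Leaf: "free_letters (Leaf ` J)"
proof -
  have "alg_hom alg_val f = f" if "f \<in> words_in (Leaf ` J)" for f
  proof -
    have "prod_list (map alg_val w) = word w" if "w \<in> lists (Leaf ` J)" for w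
      using that
    proof (induction w)
      case (Cons a w)
      then show ?case
        by (auto simp: word_Cons[of _ w])
    qed (simp add: word_Nil)
    then have "alg_hom alg_val f = lin_ext word f"
      using that unfolding alg_hom_def words_in_def by (auto intro!: lin_ext_cong)
    then show ?thesis
      by (simp add: lin_ext_word_id)
  qed
  then show ?thesis
    by (simp add: free_letters_def)
qed

section \<open>Hall trees\<close>

text \<open>This turns equal numbers of trees in every multidegree into a bijection that preserves
  the multidegree. It is glued from bijections between the fibers.\<close>

lemma fiberwise_bij:
  assumes "\<And>v. finite {x \<in> A. f x = v}" and "\<And>v. finite {y \<in> B. g y = v}"
    and "\<And>v. card {x \<in> A. f x = v} = card {y \<in> B. g y = v}"
  obtains \<beta> where "bij_betw \<beta> A B" and "\<And>x. x \<in> A \<Longrightarrow> g (\<beta> x) = f x"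
proof -
  have "\<forall>v. \<exists>b. bij_betw b {x \<in> A. f x = v} {y \<in> B. g y = v}"
    using assms by (meson finite_same_card_bij)
  then obtain b where b: "\<And>v. bij_betw (b v) {x \<in> A. f x = v} {y \<in> B. g y = v}"
    by metis
  define \<beta> where "\<beta> x = b (f x) x" for x
  have \<beta>: "\<beta> x \<in> B \<and> g (\<beta> x) = f x" if "x \<in> A" for x
    using bij_betwE[OF b[of "f x"]] that by (auto simp: \<beta>_def)
  have "bij_betw \<beta> A B"
    unfolding bij_betw_def
  proof
    show "inj_on \<beta> A"
    proof (rule inj_onI)
      fix x y assume xy: "x \<in> A" "y \<in> A" "\<beta> x = \<beta> y"
      then have "f x = f y"
        using \<beta> by metis
      with xy bij_betw_imp_inj_on[OF b[of "f x"]] show "x = y"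
        by (auto simp: \<beta>_def dest: inj_onD)
    qed
    show "\<beta> ` A = B"
    proof (intro equalityI subsetI)
      fix y assume "y \<in> B"
      then have "y \<in> b (g y) ` {x \<in> A. f x = g y}"
        using bij_betw_imp_surj_on[OF b[of "g y"]] by simp
      then obtain x where "x \<in> A" "f x = g y" "y = b (g y) x"
        by auto
      then show "y \<in> \<beta> ` A"
        by (metis \<beta>_def imageI)
    qed (use \<beta> in auto)
  qed
  with \<beta> that show ?thesis
    by blast
qed

text \<open>The order is given on all trees in advance instead of being extended degree by degree,
  so that \<open>hall_tree\<close> is a plain recursion.\<close>

locale hall_order =
  fixes lt :: "tree \<Rightarrow> tree \<Rightarrow> bool"
  assumes irrefl: "\<not> lt s s"
    and trans: "lt s t \<Longrightarrow> lt t u \<Longrightarrow> lt s u"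
    and total: "s \<noteq> t \<Longrightarrow> lt s t \<or> lt t s"
    and deg_less: "deg s < deg t \<Longrightarrow> lt s t"
begin

text \<open>As the order is total, the last condition says that \<open>t1\<close> is at most
  \<open>s\<close>.\<close>

fun hall_tree :: "nat set \<Rightarrow> tree \<Rightarrow> bool" where
  "hall_tree J (Leaf i) \<longleftrightarrow> i \<in> J"
| "hall_tree J (Node s t) \<longleftrightarrow>
     hall_tree J s \<and> hall_tree J t \<and> lt s t \<and> (\<forall>t1 t2. t = Node t1 t2 \<longrightarrow> \<not> lt s t1)"

text \<open>For an initial segment \<open>E\<close> of the Hall trees this is the alphabet left once
  \<open>E\<close> has been eliminated: a bracket appears when its left factor is eliminated and
  disappears when it is eliminated itself.\<close>

definition hall_letters :: "nat set \<Rightarrow> tree set \<Rightarrow> tree set" where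
  "hall_letters J E = {t. hall_tree J t \<and> t \<notin> E \<and> (\<forall>u v. t = Node u v \<longrightarrow> u \<in> E)}"

lemma asym: "lt s t \<Longrightarrow> \<not> lt t s"
  using irrefl trans by blast

lemma deg_le: "lt s t \<Longrightarrow> deg s \<le> deg t"
  using asym deg_less by (meson not_le)

lemma lt_Node: "lt s (Node s t)" "lt t (Node s t)"
  using deg_pos[of s] deg_pos[of t] by (simp_all add: deg_less)

lemma hall_tree_leaves: "hall_tree J t \<Longrightarrow> leaves t \<subseteq> J"
  by (induction t) auto

lemma hall_tree_mono: "hall_tree I t \<Longrightarrow> leaves t \<subseteq> J \<Longrightarrow> hall_tree J t"
  by (induction t) auto

lemma hall_letters_empty: "hall_letters J {} = Leaf ` J"
proof -
  have "t \<in> hall_letters J {} \<longleftrightarrow> t \<in> Leaf ` J" for t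
    by (cases t) (auto simp: hall_letters_def)
  then show ?thesis
    by blast
qed

text \<open>A bracket [y, b] is a Hall tree exactly if b is a Hall tree above y whose left factor,
  if there is one, is at most y. This says that b is itself a letter after the elimination of y, so
  the Hall condition matches the recursion of \<open>elim_letter\<close>.\<close>

lemma hall_letters_insert:
  assumes y: "hall_tree J y"
  defines "E \<equiv> {s. hall_tree J s \<and> lt s y}"
  shows "y \<in> hall_letters J E" and "no_left y (hall_letters J E)" and "y \<notin> E"
    and "hall_letters J (insert y E) = elim_letter y (hall_letters J E)"
proof -
  show "y \<in> hall_letters J E"
    using y lt_Node(1) irrefl by (auto simp: hall_letters_def E_def)
  show "y \<notin> E"
    using irrefl by (simp add: E_def)
  then show "no_left y (hall_letters J E)"
    by (auto simp: no_left_def hall_letters_def)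
  show "hall_letters J (insert y E) = elim_letter y (hall_letters J E)"
  proof (intro equalityI subsetI)
    fix t assume "t \<in> hall_letters J (insert y E)"
    then show "t \<in> elim_letter y (hall_letters J E)"
    proof (induction t)
      case (Leaf i)
      then show ?case
        by (intro elim_letter.keep) (auto simp: hall_letters_def)
    next
      case (Node s b)
      show ?case
      proof (cases "s = y")
        case True
        with Node.prems have b: "hall_tree J b" "lt y b" "\<forall>u v. b = Node u v \<longrightarrow> \<not> lt y u"
          by (auto simp: hall_letters_def)
        have "u \<in> insert y E" if "b = Node u v" for u v
          using b that total[of u y] by (auto simp: E_def)
        with b have "b \<in> hall_letters J (insert y E)"
          using irrefl asym by (auto simp: hall_letters_def E_def)
        with Node.IH(2) True show ?thesis
          by (simp add: elim_letter.brk)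
      next
        case False
        with Node.prems show ?thesis
          by (intro elim_letter.keep) (auto simp: hall_letters_def)
      qed
    qed
  next
    fix t assume "t \<in> elim_letter y (hall_letters J E)"
    then show "t \<in> hall_letters J (insert y E)"
    proof (induction rule: elim_letter.induct)
      case (keep a)
      then show ?case
        by (auto simp: hall_letters_def)
    next
      case (brk b)
      then have b: "hall_tree J b" "b \<noteq> y" "b \<notin> E" "\<forall>u v. b = Node u v \<longrightarrow> u \<in> insert y E"
        by (auto simp: hall_letters_def)
      then have "lt y b"
        using total[of y b] by (auto simp: E_def)
      moreover have "\<not> lt y u" if "b = Node u v" for u v
        using b(4) that irrefl asym by (auto simp: E_def)
      moreover have "\<not> lt (Node y b) y"
        using lt_Node(1) asym by blast
      ultimately show ?case
        using y b by (auto simp: hall_letters_def E_def Node_neq)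
    qed
  qed
qed

text \<open>The induction takes away the largest element \<open>y\<close> of \<open>E\<close>, which
  is eliminated last. By downward closure the remainder consists of all Hall trees below
  \<open>y\<close>, as \<open>hall_letters_insert\<close> requires.\<close>

lemma hall_elimination:
  assumes "finite E" and "E \<subseteq> Collect (hall_tree J)"
    and "\<And>s t. t \<in> E \<Longrightarrow> hall_tree J s \<Longrightarrow> lt s t \<Longrightarrow> s \<in> E"
  shows "free_letters (hall_letters J E)"
    and "card (weighted_pairs (hall_letters J E) E m) = card (weighted_pairs (Leaf ` J) {} m)"
proof -
  have "free_letters (hall_letters J E) \<and>
    card (weighted_pairs (hall_letters J E) E m) = card (weighted_pairs (Leaf ` J) {} m)"
    using assms
  proof (induction E rule: finite_psubset_induct)
    case (psubset E)
    show ?case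
    proof (cases "E = {}")
      case True
      then show ?thesis
        by (simp add: hall_letters_empty free_letters_Leaf)
    next
      case False
      have "\<exists>y\<in>E. \<forall>x\<in>E. x \<noteq> y \<longrightarrow> \<not> lt y x"
        by (rule Finite_Set.bex_max_element[OF psubset.hyps(1) _ _ False])
          (auto intro: asymp_onI transp_onI dest: asym trans)
      then obtain y where y: "y \<in> E" and max: "\<And>x. x \<in> E \<Longrightarrow> x \<noteq> y \<Longrightarrow> lt x y"
        using total by blast
      define E' where "E' = {s. hall_tree J s \<and> lt s y}"
      have hy: "hall_tree J y"
        using y psubset.prems(1) by blast
      note ins = hall_letters_insert[OF hy, folded E'_def]
      have E: "E = insert y E'"
        using y max psubset.prems hy unfolding E'_def by blast
      have "free_letters (hall_letters J E') \<and>
        card (weighted_pairs (hall_letters J E') E' m) = card (weighted_pairs (Leaf ` J) {} m)"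
      proof (rule psubset.IH)
        show "E' \<subset> E"
          using E ins(3) by blast
        show "E' \<subseteq> Collect (hall_tree J)"
          by (auto simp: E'_def)
        show "s \<in> E'" if "t \<in> E'" "hall_tree J s" "lt s t" for s t
          using that trans by (auto simp: E'_def)
      qed
      then show ?thesis
        using free_letters_elim[OF ins(1,2)] card_weighted_pairs_elim[OF ins(1-3), of m]
        by (simp add: E ins(4))
    qed
  qed
  then show "free_letters (hall_letters J E)"
    and "card (weighted_pairs (hall_letters J E) E m) = card (weighted_pairs (Leaf ` J) {} m)"
    by simp_all
qed

section \<open>Elimination of all Hall trees of small degree\<close>

definition hall_below :: "nat set \<Rightarrow> nat \<Rightarrow> tree set" where
  "hall_below J n = {t. hall_tree J t \<and> deg t < n}"

lemma finite_hall_trees: "finite J \<Longrightarrow> finite {t. hall_tree J t \<and> deg t \<le> n}"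
  by (rule finite_subset[OF _ finite_trees[of J n]]) (auto dest: hall_tree_leaves)

lemma hall_below_elimination:
  assumes "finite J"
  shows "free_letters (hall_letters J (hall_below J n))"
    and "card (weighted_pairs (hall_letters J (hall_below J n)) (hall_below J n) m)
      = card (weighted_pairs (Leaf ` J) {} m)"
proof -
  have *: "finite (hall_below J n)" "hall_below J n \<subseteq> Collect (hall_tree J)"
    by (auto simp: hall_below_def intro: finite_subset[OF _ finite_hall_trees[OF assms, of n]])
  \<comment> \<open>The order refines the degree, so the Hall trees of degree less than
    \<open>n\<close> form an initial segment.\<close>
  have **: "s \<in> hall_below J n" if "t \<in> hall_below J n" "hall_tree J s" "lt s t" for s t
    using that deg_le[of s t] by (simp add: hall_below_def)
  show "free_letters (hall_letters J (hall_below J n))"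
    and "card (weighted_pairs (hall_letters J (hall_below J n)) (hall_below J n) m)
      = card (weighted_pairs (Leaf ` J) {} m)"
    using hall_elimination[OF *] ** by blast+
qed

text \<open>The left factor of a tree of degree \<open>n\<close> has smaller degree and is therefore
  already eliminated.\<close>

lemma hall_letters_below: "hall_tree J t \<Longrightarrow> deg t = n \<Longrightarrow> t \<in> hall_letters J (hall_below J n)"
  using deg_pos by (auto simp: hall_letters_def hall_below_def)

text \<open>Both trees are letters of the alphabet left by the elimination of all smaller degrees,
  and free letters have distinct values.\<close>

lemma alg_val_inj:
  assumes "hall_tree I s" and "hall_tree I t" and "deg s = deg t" and "alg_val s = alg_val t"
  shows "s = t"
proof -
  \<comment> \<open>Passing to the leaves that occur gives finitely many generators even if
    \<open>I\<close> is infinite.\<close>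
  let ?J = "leaves s \<union> leaves t"
  have "hall_tree ?J s" "hall_tree ?J t"
    using assms(1,2) by (auto intro: hall_tree_mono)
  then have "s \<in> hall_letters ?J (hall_below ?J (deg s))" "t \<in> hall_letters ?J (hall_below ?J (deg s))"
    using assms(3) by (simp_all add: hall_letters_below)
  moreover have "free_letters (hall_letters ?J (hall_below ?J (deg s)))"
    by (rule hall_below_elimination) (simp add: finite_leaves)
  ultimately show ?thesis
    using free_letters_inj assms(4) by blast
qed

lemma lie_val_inj:
  "hall_tree I s \<Longrightarrow> hall_tree I t \<Longrightarrow> deg s = deg t \<Longrightarrow> lie_val s = lie_val t \<Longrightarrow> s = t"
  by (metis alg_val_inj lie_alg_lie_val)

text \<open>Every tree adds at least 1 to the total degree, which bounds the size of the
  multisets.\<close>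

lemma finite_weight_multisets:
  assumes "finite E"
  shows "finite {M. set_mset M \<subseteq> E \<and> mwt M = m}"
proof -
  have "size M \<le> total_degree (mwt M)" for M
  proof (induction M)
    case (add t M)
    then show ?case
      using deg_pos[of t] by simp
  qed simp
  then have "M \<in> mset ` {w. set w \<subseteq> E \<and> length w \<le> total_degree m}"
    if "set_mset M \<subseteq> E" "mwt M = m" for M
    using that by (metis (mono_tags, lifting) ex_mset image_eqI mem_Collect_eq set_mset_mset size_mset)
  then have "{M. set_mset M \<subseteq> E \<and> mwt M = m}
      \<subseteq> mset ` {w. set w \<subseteq> E \<and> length w \<le> total_degree m}"
    by blast
  then show ?thesis
    by (rule finite_subset) (intro finite_imageI finite_lists_length_le assms)
qed

text \<open>The letters left after the elimination have degree at least \<open>n\<close>, so a pair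
  of weight \<open>m\<close> is either one letter with the empty multiset or the empty word with a
  multiset of eliminated trees. The right-hand side counts words in the generators and does not
  involve the order.\<close>

lemma card_hall_trees_add:
  assumes J: "finite J" and n: "total_degree m = n" "0 < n"
  shows "card {t. hall_tree J t \<and> mdeg t = m} + card {M. set_mset M \<subseteq> hall_below J n \<and> mwt M = m}
    = card (weighted_pairs (Leaf ` J) {} m)"
proof -
  let ?A = "hall_letters J (hall_below J n)"
  let ?T = "{t. hall_tree J t \<and> mdeg t = m}"
  let ?M = "{M. set_mset M \<subseteq> hall_below J n \<and> mwt M = m}"
  have "weighted_pairs ?A (hall_below J n) m = (\<lambda>t. ([t], {#})) ` ?T \<union> Pair [] ` ?M"
  proof (intro equalityI subsetI)
    fix p assume "p \<in> weighted_pairs ?A (hall_below J n) m"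
    then obtain w M where p: "p = (w, M)" and w: "w \<in> lists ?A" and M: "set_mset M \<subseteq> hall_below J n"
      and wM: "wt w + mwt M = m"
      by (auto simp: weighted_pairs_def)
    show "p \<in> (\<lambda>t. ([t], {#})) ` ?T \<union> Pair [] ` ?M"
    proof (cases w)
      case Nil
      with p M wM show ?thesis
        by simp
    next
      case (Cons t u)
      with w have t: "hall_tree J t" "n \<le> deg t"
        by (auto simp: hall_letters_def hall_below_def)
      have "deg t + total_degree (wt u) + total_degree (mwt M) = n"
        using wM n(1) unfolding Cons by auto
      with t have "total_degree (wt u) = 0" "total_degree (mwt M) = 0"
        by linarith+
      moreover have "u = []" if "total_degree (wt u) = 0"
        using that deg_pos[of "hd u"] by (cases u) simp_all
      moreover have "M = {#}" if "total_degree (mwt M) = 0"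
        using that deg_pos deg_le_total_degree_mwt by (metis le_zero_eq multiset_nonemptyE not_less_zero)
      ultimately show ?thesis
        using p t wM Cons by auto
    qed
  next
    fix p assume "p \<in> (\<lambda>t. ([t], {#})) ` ?T \<union> Pair [] ` ?M"
    then show "p \<in> weighted_pairs ?A (hall_below J n) m"
      using hall_letters_below n(1) by (auto simp: weighted_pairs_def)
  qed
  moreover have "card ((\<lambda>t. ([t], {#})) ` ?T \<union> Pair [] ` ?M) = card ?T + card ?M"
  proof (subst card_Un_disjoint)
    show "finite ((\<lambda>t. ([t], {#})) ` ?T)"
      by (rule finite_imageI, rule finite_subset[OF _ finite_hall_trees[OF J, of n]]) (use n in auto)
    show "finite (Pair [] ` ?M)"
      by (intro finite_imageI finite_weight_multisets)
        (auto simp: hall_below_def intro: finite_subset[OF _ finite_hall_trees[OF J, of n]])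
  qed (auto simp: card_image inj_on_def)
  ultimately show ?thesis
    using hall_below_elimination(2)[OF J, of n m] by simp
qed

end

section \<open>Independence of the order and of the rank\<close>

lemma card_weight_multisets_cong:
  assumes "bij_betw \<beta> A B" and "\<And>t. t \<in> A \<Longrightarrow> mdeg (\<beta> t) = mdeg t"
  shows "card {M. set_mset M \<subseteq> A \<and> mwt M = m} = card {M. set_mset M \<subseteq> B \<and> mwt M = m}"
proof (rule bij_betw_same_card)
  let ?\<gamma> = "the_inv_into A \<beta>"
  have inj: "inj_on \<beta> A" and surj: "\<beta> ` A = B"
    using assms(1) by (simp_all add: bij_betw_def)
  have \<beta>: "mwt (image_mset \<beta> M) = mwt M" if "set_mset M \<subseteq> A" for M
    using that by (induction M) (simp_all add: assms(2))
  have \<gamma>: "?\<gamma> t \<in> A" "\<beta> (?\<gamma> t) = t" if "t \<in> B" for t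
    using that surj the_inv_into_into[OF inj] f_the_inv_into_f[OF inj] by auto
  have id: "image_mset f M = M" if "\<And>t. t \<in># M \<Longrightarrow> f t = t" for f and M :: "tree multiset"
    using that by (induction M) simp_all
  have 1: "image_mset ?\<gamma> (image_mset \<beta> M) = M" if "set_mset M \<subseteq> A" for M
    using that inj by (auto simp: multiset.map_comp the_inv_into_f_f intro!: id)
  have 2: "image_mset \<beta> (image_mset ?\<gamma> M) = M" if "set_mset M \<subseteq> B" for M
    using that \<gamma> by (auto simp: multiset.map_comp intro!: id)
  show "bij_betw (image_mset \<beta>) {M. set_mset M \<subseteq> A \<and> mwt M = m} {M. set_mset M \<subseteq> B \<and> mwt M = m}"
  proof (rule bij_betw_byWitness[of _ "image_mset ?\<gamma>"])
    show "image_mset \<beta> ` {M. set_mset M \<subseteq> A \<and> mwt M = m} \<subseteq> {M. set_mset M \<subseteq> B \<and> mwt M = m}"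
    proof (rule image_subsetI)
      fix M assume "M \<in> {M. set_mset M \<subseteq> A \<and> mwt M = m}"
      then have M: "set_mset M \<subseteq> A" "mwt M = m"
        by simp_all
      then have "\<beta> ` set_mset M \<subseteq> B"
        using surj by blast
      with \<beta>[OF M(1)] M(2) show "image_mset \<beta> M \<in> {M. set_mset M \<subseteq> B \<and> mwt M = m}"
        by simp
    qed
    show "image_mset ?\<gamma> ` {M. set_mset M \<subseteq> B \<and> mwt M = m} \<subseteq> {M. set_mset M \<subseteq> A \<and> mwt M = m}"
    proof (rule image_subsetI)
      fix M assume "M \<in> {M. set_mset M \<subseteq> B \<and> mwt M = m}"
      then have M: "set_mset M \<subseteq> B" "mwt M = m"
        by simp_all
      then have A: "set_mset (image_mset ?\<gamma> M) \<subseteq> A"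
        using \<gamma>(1) by auto
      with \<beta>[OF A] 2[OF M(1)] M(2) show "image_mset ?\<gamma> M \<in> {M. set_mset M \<subseteq> A \<and> mwt M = m}"
        by simp
    qed
  qed (use 1 2 in simp_all)
qed

text \<open>The total in \<open>card_hall_trees_add\<close> depends only on \<open>J\<close> and
  \<open>m\<close>. By induction the smaller Hall trees for the two orders match in every
  multidegree, hence so do the multisets of them, and subtraction gives the claim.\<close>

lemma card_hall_trees_order_indep:
  assumes "hall_order lt" and "hall_order lt'" and "finite J"
  shows "card {t. hall_order.hall_tree lt J t \<and> mdeg t = m}
    = card {t. hall_order.hall_tree lt' J t \<and> mdeg t = m}"
proof (induction "total_degree m" arbitrary: m rule: less_induct)
  case less
  interpret L: hall_order lt by fact
  interpret L': hall_order lt' by fact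
  let ?n = "total_degree m"
  show ?case
  proof (cases "?n = 0")
    case True
    then have "mdeg t \<noteq> m" for t
      using deg_pos[of t] total_degree_mdeg[of t] by auto
    then show ?thesis
      by simp
  next
    case False
    have fin: "finite {t \<in> L.hall_below J ?n. mdeg t = v}" "finite {t \<in> L'.hall_below J ?n. mdeg t = v}"
      for v
      by (auto simp: L.hall_below_def L'.hall_below_def
        intro: finite_subset[OF _ L.finite_hall_trees[OF assms(3), of ?n]]
          finite_subset[OF _ L'.finite_hall_trees[OF assms(3), of ?n]])
    have "card {t \<in> L.hall_below J ?n. mdeg t = v} = card {t \<in> L'.hall_below J ?n. mdeg t = v}" for v
    proof (cases "total_degree v < ?n")
      case True
      then have "{t \<in> L.hall_below J ?n. mdeg t = v} = {t. L.hall_tree J t \<and> mdeg t = v}"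
        "{t \<in> L'.hall_below J ?n. mdeg t = v} = {t. L'.hall_tree J t \<and> mdeg t = v}"
        by (auto simp: L.hall_below_def L'.hall_below_def)
      with less[OF True] show ?thesis
        by simp
    next
      case False
      then have "{t \<in> L.hall_below J ?n. mdeg t = v} = {}" "{t \<in> L'.hall_below J ?n. mdeg t = v} = {}"
        by (auto simp: L.hall_below_def L'.hall_below_def)
      then show ?thesis
        by (simp only: card.empty)
    qed
    then obtain \<beta> where "bij_betw \<beta> (L.hall_below J ?n) (L'.hall_below J ?n)"
      and "\<And>t. t \<in> L.hall_below J ?n \<Longrightarrow> mdeg (\<beta> t) = mdeg t"
      using fiberwise_bij[OF fin] by metis
    then have "card {M. set_mset M \<subseteq> L.hall_below J ?n \<and> mwt M = m}
      = card {M. set_mset M \<subseteq> L'.hall_below J ?n \<and> mwt M = m}"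
      by (rule card_weight_multisets_cong)
    then show ?thesis
      using L.card_hall_trees_add[OF assms(3) refl, of m] L'.card_hall_trees_add[OF assms(3) refl, of m]
        False by linarith
  qed
qed

text \<open>The leaves of a tree of multidegree \<open>m\<close> are the support of
  \<open>m\<close>, so any index set that contains the support can be replaced by it. This removes
  the rank and leaves finitely many generators.\<close>

lemma card_hall_trees_indep:
  assumes "hall_order lt" and "hall_order lt'"
    and "Poly_Mapping.keys m \<subseteq> I" and "Poly_Mapping.keys m \<subseteq> I'"
  shows "card {t. hall_order.hall_tree lt I t \<and> mdeg t = m}
    = card {t. hall_order.hall_tree lt' I' t \<and> mdeg t = m}"
proof -
  let ?J = "Poly_Mapping.keys m"
  have restrict: "{t. hall_order.hall_tree lt I t \<and> mdeg t = m}
      = {t. hall_order.hall_tree lt ?J t \<and> mdeg t = m}"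
    if "hall_order lt" "?J \<subseteq> I" for lt I
  proof -
    interpret hall_order lt by fact
    have "hall_tree I t \<longleftrightarrow> hall_tree ?J t" if "mdeg t = m" for t
      using hall_tree_mono[of I t ?J] hall_tree_mono[of ?J t I] \<open>?J \<subseteq> I\<close> keys_mdeg[of t] that
      by blast
    then show ?thesis
      by blast
  qed
  show ?thesis
    unfolding restrict[OF assms(1,3)] restrict[OF assms(2,4)]
    by (rule card_hall_trees_order_indep) (simp_all add: assms)
qed

lemma (in hall_order) finite_hall_trees_mdeg: "finite {t. hall_tree J t \<and> mdeg t = m}"
proof (rule finite_subset[OF _ finite_trees[of "Poly_Mapping.keys m" "total_degree m"]])
  show "{t. hall_tree J t \<and> mdeg t = m}
    \<subseteq> {t. leaves t \<subseteq> Poly_Mapping.keys m \<and> deg t \<le> total_degree m}"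
    by (auto simp: keys_mdeg)
qed simp

section \<open>Hall sets as families of Hall trees\<close>

text \<open>\<open>hall_order\<close> compares all trees, including those whose values lie outside
  the Hall set, so the order on the Hall set is extended to the whole type.\<close>

lemma linear_order_on_extend:
  assumes "linear_order_on A le"
  obtains r :: "'a \<Rightarrow> 'a \<Rightarrow> bool" where
    "\<And>x. \<not> r x x" "\<And>x y z. r x y \<Longrightarrow> r y z \<Longrightarrow> r x z" "\<And>x y. x \<noteq> y \<Longrightarrow> r x y \<or> r y x"
    "\<And>x y. x \<in> A \<Longrightarrow> y \<in> A \<Longrightarrow> r x y \<longleftrightarrow> (x, y) \<in> le - Id"
proof -
  obtain w :: "'a rel" where w: "linear_order_on UNIV w"
    using well_order_on[of UNIV] unfolding well_order_on_def by blast
  \<comment> \<open>\<open>A\<close> comes first in its own order, and its complement follows in an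
    arbitrary linear order.\<close>
  define r where "r x y \<longleftrightarrow> x \<noteq> y \<and>
    (if x \<in> A then y \<in> A \<longrightarrow> (x, y) \<in> le else y \<notin> A \<and> (x, y) \<in> w)" for x y
  have le: "(x, y) \<in> le \<Longrightarrow> (y, z) \<in> le \<Longrightarrow> (x, z) \<in> le" "(x, y) \<in> le \<Longrightarrow> (y, x) \<in> le \<Longrightarrow> x = y"
    "x \<in> A \<Longrightarrow> y \<in> A \<Longrightarrow> x \<noteq> y \<Longrightarrow> (x, y) \<in> le \<or> (y, x) \<in> le" for x y z
    using assms
    by (auto simp: linear_order_on_def partial_order_on_def preorder_on_def total_on_def
      dest: transD antisymD)
  have w: "(x, y) \<in> w \<Longrightarrow> (y, z) \<in> w \<Longrightarrow> (x, z) \<in> w" "(x, y) \<in> w \<Longrightarrow> (y, x) \<in> w \<Longrightarrow> x = y"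
    "x \<noteq> y \<Longrightarrow> (x, y) \<in> w \<or> (y, x) \<in> w" for x y z
    using w
    by (auto simp: linear_order_on_def partial_order_on_def preorder_on_def total_on_def
      dest: transD antisymD)
  show ?thesis
  proof (rule that[of r])
    show "r x z" if "r x y" "r y z" for x y z
      using that le(1,2) w(1,2) unfolding r_def by (smt (verit))
    show "r x y \<or> r y x" if "x \<noteq> y" for x y
      using that le(3) w(3) unfolding r_def by (smt (verit))
  qed (auto simp: r_def)
qed

lemma mem_hall_pairs:
  "(Y, Z) \<in> hall_pairs H le n \<longleftrightarrow> (\<exists>b. 1 \<le> b \<and> b < n \<and> Y \<in> H (n - b) \<and> Z \<in> H b \<and> (Y, Z) \<in> le - Id \<and>
     (\<forall>Z1 Z2. (Z1, Z2) \<in> hall_pairs H le b \<longrightarrow> Z = bracket Z1 Z2 \<longrightarrow> (Z1, Y) \<in> le))"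
  by (subst hall_pairs.simps) auto

lemma hall_setD:
  assumes "hall_set I H le"
  shows "linear_order_on (\<Union>n\<in>{1..}. H n) le" and "H 1 = gen ` I"
    and "\<And>i j. i \<in> I \<Longrightarrow> j \<in> I \<Longrightarrow> i < j \<Longrightarrow> (gen i, gen j) \<in> le - Id"
    and "\<And>n. 2 \<le> n \<Longrightarrow> H n = (\<lambda>(Y, Z). bracket Y Z) ` hall_pairs H le n"
    and "\<And>j n. 1 \<le> j \<Longrightarrow> j < n \<Longrightarrow> H j \<times> H n \<subseteq> le - Id"
proof -
  note 1 = conjunct2[OF assms[unfolded hall_set_def]]
  note 2 = conjunct2[OF 1]
  note 3 = conjunct2[OF 2]
  note 4 = conjunct2[OF 3]
  show "linear_order_on (\<Union>n\<in>{1..}. H n) le"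
    by (rule conjunct1[OF assms[unfolded hall_set_def]])
  show "H 1 = gen ` I"
    by (rule conjunct1[OF 1])
  show "(gen i, gen j) \<in> le - Id" if "i \<in> I" "j \<in> I" "i < j" for i j
    using conjunct1[OF 2] that by blast
  show "H n = (\<lambda>(Y, Z). bracket Y Z) ` hall_pairs H le n" if "2 \<le> n" for n
    using conjunct1[OF 3] that by blast
  show "H j \<times> H n \<subseteq> le - Id" if "1 \<le> j" "j < n" for j n
    using 4 that by (meson atLeastLessThan_iff)
qed

text \<open>
  Trees are compared by degree, then by an extension of \<open>le\<close> to all Lie elements, and ties are
  broken arbitrarily.  This order is total before it is known that the values of the Hall trees
  are distinct and lie in the Hall set.
\<close>

lemma hall_set_order:
  assumes "hall_set I H le"
  obtains lt where "hall_order lt"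
    and "\<And>s t. lie_val s \<in> H (deg s) \<Longrightarrow> lie_val t \<in> H (deg t) \<Longrightarrow>
      lie_val s \<noteq> lie_val t \<or> deg s \<noteq> deg t \<or> s = t \<Longrightarrow> lt s t \<longleftrightarrow> (lie_val s, lie_val t) \<in> le - Id"
proof -
  let ?A = "\<Union>n\<in>{1..}. H n"
  note lin = hall_setD(1)[OF assms] and levels = hall_setD(5)[OF assms]
  obtain r where r: "\<And>x. \<not> r x x" "\<And>x y z. r x y \<Longrightarrow> r y z \<Longrightarrow> r x z" "\<And>x y. x \<noteq> y \<Longrightarrow> r x y \<or> r y x"
    "\<And>x y. x \<in> ?A \<Longrightarrow> y \<in> ?A \<Longrightarrow> r x y \<longleftrightarrow> (x, y) \<in> le - Id"
    by (rule linear_order_on_extend[OF lin]) (rule that; assumption)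
  obtain w :: "tree rel" where "linear_order_on UNIV w"
    using well_order_on[of UNIV] unfolding well_order_on_def by blast
  then obtain q where q: "\<And>x. \<not> q x x" "\<And>x y z. q x y \<Longrightarrow> q y z \<Longrightarrow> q x z"
    "\<And>x y :: tree. x \<noteq> y \<Longrightarrow> q x y \<or> q y x"
    by (rule linear_order_on_extend) (rule that; assumption)
  define lt where "lt s t \<longleftrightarrow> deg s < deg t \<or>
    deg s = deg t \<and> (r (lie_val s) (lie_val t) \<or> lie_val s = lie_val t \<and> q s t)" for s t
  have "hall_order lt"
  proof
    show "lt s u" if "lt s t" "lt t u" for s t u
      using that unfolding lt_def by (auto dest: r(2) q(2))
    show "lt s t \<or> lt t s" if "s \<noteq> t" for s t
      using that r(3)[of "lie_val s" "lie_val t"] q(3)[of s t] unfolding lt_def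
      by (cases "lie_val s = lie_val t") auto
  qed (auto simp: lt_def r(1) q(1))
  moreover have "lt s t \<longleftrightarrow> (lie_val s, lie_val t) \<in> le - Id"
    if "lie_val s \<in> H (deg s)" "lie_val t \<in> H (deg t)" "lie_val s \<noteq> lie_val t \<or> deg s \<noteq> deg t \<or> s = t"
    for s t
  proof -
    have A: "lie_val s \<in> ?A" "lie_val t \<in> ?A"
      using that deg_pos[of s] deg_pos[of t] by (auto simp: Suc_le_eq)
    consider "deg s < deg t" | "deg t < deg s" | "deg s = deg t"
      by linarith
    then show ?thesis
    proof cases
      case 1
      then have "(lie_val s, lie_val t) \<in> le - Id"
        using levels[of "deg s" "deg t"] that(1,2) deg_pos[of s] by auto
      with 1 show ?thesis
        by (simp add: lt_def)
    next
      case 2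
      then have "(lie_val t, lie_val s) \<in> le - Id"
        using levels[of "deg t" "deg s"] that(1,2) deg_pos[of t] by auto
      then have "(lie_val s, lie_val t) \<notin> le - Id"
        using r(1,2,4) A by blast
      with 2 show ?thesis
        by (simp add: lt_def)
    next
      case 3
      with that(3) r(4)[OF A] q(1) show ?thesis
        by (auto simp: lt_def)
    qed
  qed
  ultimately show ?thesis
    by (rule that)
qed

text \<open>
  The construction of a Hall set looks at Lie elements rather than trees.  The two agree because
  distinct Hall trees of the same degree have distinct values.
\<close>

lemma hall_set_trees:
  assumes "hall_set I H le"
  obtains lt where "hall_order lt"
    and "\<And>i j. i \<in> I \<Longrightarrow> j \<in> I \<Longrightarrow> i < j \<Longrightarrow> lt (Leaf i) (Leaf j)"
    and "\<And>n. 1 \<le> n \<Longrightarrow> bij_betw lie_val {t. hall_order.hall_tree lt I t \<and> deg t = n} (H n)"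
    and "\<And>t. hall_order.hall_tree lt I t \<Longrightarrow> eta H le (lie_val t) = mdeg t"
proof -
  obtain lt where lt: "hall_order lt"
    and order_iff: "\<And>s t. lie_val s \<in> H (deg s) \<Longrightarrow> lie_val t \<in> H (deg t) \<Longrightarrow>
      lie_val s \<noteq> lie_val t \<or> deg s \<noteq> deg t \<or> s = t \<Longrightarrow> lt s t \<longleftrightarrow> (lie_val s, lie_val t) \<in> le - Id"
    using hall_set_order[OF assms] by blast
  interpret hall_order lt
    by fact
  let ?A = "\<Union>n\<in>{1..}. H n"
  let ?T = "\<lambda>n. {t. hall_tree I t \<and> deg t = n}"
  let ?P = "\<lambda>n. {(lie_val s, lie_val t) | s t. hall_tree I (Node s t) \<and> deg (Node s t) = n}"
  note lin = hall_setD(1)[OF assms] and H1 = hall_setD(2)[OF assms] and gens = hall_setD(3)[OF assms]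
    and HS = hall_setD(4)[OF assms] and levels = hall_setD(5)[OF assms]
  have le_refl: "x \<in> ?A \<Longrightarrow> (x, x) \<in> le" and le_antisym: "(x, y) \<in> le \<Longrightarrow> (y, x) \<in> le \<Longrightarrow> x = y" for x y
    using lin by (auto simp: linear_order_on_def partial_order_on_def preorder_on_def
      dest: refl_onD antisymD)
  \<comment> \<open>Injectivity in each degree excludes ties, so \<open>lt\<close> agrees with the
    order of the Hall set here.\<close>
  have order: "lt s t \<longleftrightarrow> (lie_val s, lie_val t) \<in> le - Id"
    if "hall_tree I s" "hall_tree I t" "lie_val s \<in> H (deg s)" "lie_val t \<in> H (deg t)" for s t
    using order_iff[of s t] lie_val_inj[of I s t] that by blast
  \<comment> \<open>Both claims are proved together: the condition on the pairs of degree
    \<open>n\<close> refers to pairs of smaller degree, which are known by induction to come from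
    Hall trees.\<close>
  have "(1 \<le> n \<longrightarrow> H n = lie_val ` ?T n) \<and> hall_pairs H le n = ?P n" for n
  proof (induction n rule: less_induct)
    case (less n)
    have val: "lie_val t \<in> H (deg t)" if "hall_tree I t" "deg t < n" for t
      using less[OF that(2)] that(1) deg_pos[of t] by auto
    have pairs: "hall_pairs H le n = ?P n"
    proof (intro equalityI subrelI)
      fix Y Z assume "(Y, Z) \<in> hall_pairs H le n"
      then obtain b where b: "1 \<le> b" "b < n" "Y \<in> H (n - b)" "Z \<in> H b" "(Y, Z) \<in> le - Id"
        and cond: "\<And>Z1 Z2. (Z1, Z2) \<in> hall_pairs H le b \<Longrightarrow> Z = bracket Z1 Z2 \<Longrightarrow> (Z1, Y) \<in> le"
        unfolding mem_hall_pairs[of _ _ _ _ n] by blast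
      from less[of b] less[of "n - b"] b obtain s t where s: "Y = lie_val s" "hall_tree I s" "deg s = n - b"
        and t: "Z = lie_val t" "hall_tree I t" "deg t = b"
        by auto
      have "lt s t"
        using order[of s t] val[of s] val[of t] s t b by auto
      moreover have "\<not> lt s t1" if "t = Node t1 t2" for t1 t2
      proof
        assume l: "lt s t1"
        have "(lie_val t1, lie_val t2) \<in> hall_pairs H le b"
          using less[OF b(2)] t that by auto
        then have "(lie_val t1, lie_val s) \<in> le"
          using cond t(1) s(1) that by simp
        moreover have "(lie_val s, lie_val t1) \<in> le - Id"
          using order[of s t1] val[of s] val[of t1] l s t b that by auto
        ultimately show False
          using le_antisym by blast
      qed
      ultimately have "hall_tree I (Node s t)" "deg (Node s t) = n"
        using s t b by auto
      then show "(Y, Z) \<in> ?P n"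
        using s(1) t(1) by blast
    next
      fix Y Z assume "(Y, Z) \<in> ?P n"
      then obtain s t where Y: "Y = lie_val s" and Z: "Z = lie_val t"
        and st: "hall_tree I (Node s t)" "deg (Node s t) = n"
        by blast
      have hall: "hall_tree I s" "hall_tree I t" "deg s < n" "deg t < n" "n - deg t = deg s"
        using st deg_pos[of s] deg_pos[of t] by auto
      have "(Z1, Y) \<in> le" if pair: "(Z1, Z2) \<in> hall_pairs H le (deg t)" and brk: "Z = bracket Z1 Z2" for Z1 Z2
      proof -
        \<comment> \<open>The condition ranges over all pairs from which \<open>Z\<close> was
          constructed; by injectivity the only such pair comes from the two subtrees of
          \<open>t\<close>.\<close>
        obtain u v where uv: "Z1 = lie_val u" "Z2 = lie_val v" "hall_tree I (Node u v)" "deg (Node u v) = deg t"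
          using less[OF hall(4)] pair by auto
        then have t: "t = Node u v"
          using lie_val_inj[of I t "Node u v"] hall(2) brk Z by simp
        then have "\<not> lt s u"
          using st by simp
        then consider "s = u" | "lt u s"
          using total by blast
        then show ?thesis
        proof cases
          case 1
          have "lie_val s \<in> ?A"
            using val[OF hall(1,3)] deg_pos[of s] by (auto simp: Suc_le_eq)
          with 1 show ?thesis
            using le_refl uv(1) Y by simp
        next
          case 2
          then show ?thesis
            using order[of u s] val[of u] val[of s] uv hall t Y by auto
        qed
      qed
      moreover have "(Y, Z) \<in> le - Id"
        using order[of s t] val hall st Y Z by simp
      ultimately show "(Y, Z) \<in> hall_pairs H le n"
        unfolding mem_hall_pairs[of _ _ _ _ n] using hall val deg_pos[of t] Y Z
        by (intro exI[of _ "deg t"]) (auto simp: Suc_le_eq)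
    qed
    have "H n = lie_val ` ?T n" if "1 \<le> n"
    proof (cases "n = 1")
      case True
      have "?T 1 = Leaf ` I"
      proof (intro equalityI subsetI)
        fix t assume t: "t \<in> ?T 1"
        then show "t \<in> Leaf ` I"
        proof (cases t)
          case (Node u v)
          with t deg_pos[of u] deg_pos[of v] show ?thesis
            by simp
        qed auto
      qed auto
      with True show ?thesis
        by (simp only: H1 image_image lie_val.simps)
    next
      case False
      with that have "2 \<le> n"
        by simp
      have "lie_val ` ?T n = (\<lambda>(Y, Z). bracket Y Z) ` ?P n"
      proof (intro equalityI subsetI)
        fix X assume "X \<in> lie_val ` ?T n"
        then obtain t where t: "X = lie_val t" "hall_tree I t" "deg t = n"
          by blast
        show "X \<in> (\<lambda>(Y, Z). bracket Y Z) ` ?P n"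
        proof (cases t)
          case (Leaf i)
          with t False show ?thesis
            by simp
        next
          case (Node u v)
          with t show ?thesis
            by (intro image_eqI[of _ _ "(lie_val u, lie_val v)"]) auto
        qed
      next
        fix X assume "X \<in> (\<lambda>(Y, Z). bracket Y Z) ` ?P n"
        then obtain s t where "hall_tree I (Node s t)" "deg (Node s t) = n" "X = lie_val (Node s t)"
          by auto
        then show "X \<in> lie_val ` ?T n"
          by blast
      qed
      then show ?thesis
        using HS[OF \<open>2 \<le> n\<close>] pairs by simp
    qed
    with pairs show ?case
      by blast
  qed
  then have H: "\<And>n. 1 \<le> n \<Longrightarrow> H n = lie_val ` ?T n" and pairs: "\<And>n. hall_pairs H le n = ?P n"
    by blast+
  have val: "lie_val t \<in> H (deg t)" if "hall_tree I t" for t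
    using H[of "deg t"] that deg_pos[of t] by (auto simp: Suc_le_eq)
  \<comment> \<open>The order separates the levels \<open>H n\<close> strictly, so they are disjoint
    and equal values force equal degrees.\<close>
  have inj: "s = t" if st: "hall_tree I s" "hall_tree I t" "lie_val s = lie_val t" for s t
  proof (rule lie_val_inj[OF st(1,2) _ st(3)])
    show "deg s = deg t"
      using levels[of "deg s" "deg t"] levels[of "deg t" "deg s"] val[OF st(1)] val[OF st(2)] st(3)
        deg_pos[of s] deg_pos[of t] by (cases "deg s" "deg t" rule: linorder_cases) auto
  qed
  \<comment> \<open>An element of the Hall set has only one Hall tree, so \<open>eta_rel\<close> is
    single-valued there and the \<open>THE\<close> in \<open>eta\<close> is meaningful.\<close>
  have eta_rel_iff: "eta_rel H le (lie_val t) p \<longleftrightarrow> p = mdeg t" if "hall_tree I t" for t p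
  proof
    assume p: "eta_rel H le (lie_val t) p"
    have "\<exists>u. hall_tree I u \<and> lie_val u = X \<and> mdeg u = p" if "eta_rel H le X p" for X p
      using that
    proof (induction rule: eta_rel.induct)
      case (1 i)
      then have "i \<in> I"
        unfolding H1 using gen_inj by blast
      then show ?case
        by (intro exI[of _ "Leaf i"]) simp
    next
      case (2 Y Z n p q)
      then obtain s t u v where s: "hall_tree I s" "lie_val s = Y" "mdeg s = p"
        and t: "hall_tree I t" "lie_val t = Z" "mdeg t = q"
        and uv: "hall_tree I (Node u v)" "Y = lie_val u" "Z = lie_val v"
        unfolding pairs by blast
      have "u = s" "v = t"
        using inj s t uv by simp_all
      with s t uv show ?case
        by (intro exI[of _ "Node s t"]) simp
    qed
    from this[OF p] obtain u where "hall_tree I u" "lie_val u = lie_val t" "mdeg u = p"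
      by blast
    then show "p = mdeg t"
      using inj that by blast
  next
    assume p: "p = mdeg t"
    show "eta_rel H le (lie_val t) p"
      unfolding p using that
    proof (induction t)
      case (Leaf i)
      then have "gen i \<in> H 1"
        using H1 by simp
      then show ?case
        using eta_rel.intros(1) by simp
    next
      case (Node s t)
      then have "(lie_val s, lie_val t) \<in> hall_pairs H le (deg (Node s t))"
        unfolding pairs by blast
      then show ?case
        using Node eta_rel.intros(2) by simp
    qed
  qed
  show ?thesis
  proof (rule that[OF lt])
    show "lt (Leaf i) (Leaf j)" if "i \<in> I" "j \<in> I" "i < j" for i j
      using order[of "Leaf i" "Leaf j"] val[of "Leaf i"] val[of "Leaf j"] gens[OF that] that by simp
    show "bij_betw lie_val (?T n) (H n)" if "1 \<le> n" for n
      using H[OF that] inj by (auto simp: bij_betw_def inj_on_def)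
    show "eta H le (lie_val t) = mdeg t" if "hall_tree I t" for t
      by (simp add: eta_def eta_rel_iff[OF that])
  qed
qed

section \<open>Plethysm with elementary symmetric functions\<close>

definition squarefree_monomial :: "nat set \<Rightarrow> nat \<Rightarrow>\<^sub>0 nat" where
  "squarefree_monomial J = (\<Sum>j\<in>J. Poly_Mapping.single j 1)"

lemma keys_squarefree_monomial: "finite J \<Longrightarrow> Poly_Mapping.keys (squarefree_monomial J) = J"
  by (induction J rule: finite_induct) (simp_all add: squarefree_monomial_def keys_add_nat)

lemma lookup_squarefree_monomial:
  "finite J \<Longrightarrow> i \<in> J \<Longrightarrow> Poly_Mapping.lookup (squarefree_monomial J) i = 1"
  by (simp add: squarefree_monomial_def lookup_sum lookup_single when_def)

lemma subst_squarefree_monomial: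
  assumes "finite J"
  shows "subst_monomial a (squarefree_monomial J) = (\<Sum>j\<in>J. a j)"
proof -
  have "Poly_Mapping.map (\<lambda>e. Poly_Mapping.lookup (squarefree_monomial J) j * e) (a j) = a j"
    if "j \<in> J" for j
    by (rule poly_mapping_eqI)
      (simp add: lookup_squarefree_monomial[OF assms that] map.rep_eq when_def)
  then show ?thesis
    by (simp add: subst_monomial_def keys_squarefree_monomial[OF assms])
qed

lemma squarefree_monomial_inj:
  "squarefree_monomial J = squarefree_monomial K \<Longrightarrow> finite J \<Longrightarrow> finite K \<Longrightarrow> J = K"
  by (metis keys_squarefree_monomial)

text \<open>A squarefree monomial determines its set of variables, so no monomial is
  repeated.\<close>

lemma elem_sym_eq:
  "elem_sym i b = (if b \<in> squarefree_monomial ` {J. finite J \<and> card J = i} then 1 else 0)"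
proof -
  let ?F = "{K \<in> {J. finite J \<and> card J = i}. squarefree_monomial K = b}"
  have e: "elem_sym i b = int (card ?F)"
    by (simp only: elem_sym_def monomial_sum_def squarefree_monomial_def)
  show ?thesis
  proof (cases "b \<in> squarefree_monomial ` {J. finite J \<and> card J = i}")
    case True
    then obtain J where J: "J \<in> ?F"
      by blast
    moreover have "K = J" if "K \<in> ?F" for K
      by (rule squarefree_monomial_inj) (use that J in auto)
    ultimately have "?F = {J}"
      by blast
    then have "card ?F = 1"
      by (metis is_singletonI is_singleton_altdef)
    with True show ?thesis
      by (simp only: e if_True of_nat_1)
  next
    case False
    then have "?F = {}"
      by blast
    then have "card ?F = 0"
      by (metis card.empty)
    with False show ?thesis
      by (simp only: e if_False of_nat_0)
  qed
qed

text \<open>The sets \<open>J\<close> correspond to the monomials of the elementary symmetric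
  function. If infinitely many of them qualify, both sides are 0 by the conventions for
  \<open>sum\<close> and \<open>card\<close>.\<close>

lemma subst_elem_sym:
  "subst_series a (elem_sym i) m = int (card {J. finite J \<and> card J = i \<and> (\<Sum>j\<in>J. a j) = m})"
proof -
  let ?Q = "{J. finite J \<and> card J = i \<and> (\<Sum>j\<in>J. a j) = m}"
  have S: "{b. elem_sym i b \<noteq> 0 \<and> subst_monomial a b = m} = squarefree_monomial ` ?Q"
    by (auto simp: elem_sym_eq subst_squarefree_monomial dest: squarefree_monomial_inj)
  have "inj_on squarefree_monomial ?Q"
    by (rule inj_onI) (rule squarefree_monomial_inj; simp)
  then have "card (squarefree_monomial ` ?Q) = card ?Q"
    by (rule card_image)
  moreover have "(\<Sum>b\<in>squarefree_monomial ` ?Q. elem_sym i b) = (\<Sum>b\<in>squarefree_monomial ` ?Q. 1)"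
    by (rule sum.cong) (auto simp: elem_sym_eq)
  ultimately show ?thesis
    by (simp add: subst_series_def S)
qed

lemma Sum_any_card:
  assumes "finite Q"
  shows "Sum_any (\<lambda>i. (- 1) ^ i * int (card {J \<in> Q. card J = i})) = (\<Sum>J\<in>Q. (- 1) ^ card J)"
proof -
  have "Sum_any (\<lambda>i. (- 1) ^ i * int (card {J \<in> Q. card J = i}))
      = (\<Sum>i\<in>card ` Q. (- 1) ^ i * int (card {J \<in> Q. card J = i}))"
  proof (rule Sum_any.expand_superset)
    show "{i. (- 1) ^ i * int (card {J \<in> Q. card J = i}) \<noteq> 0} \<subseteq> card ` Q"
    proof
      fix i assume "i \<in> {i. (- 1) ^ i * int (card {J \<in> Q. card J = i}) \<noteq> 0}"
      then have "{J \<in> Q. card J = i} \<noteq> {}"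
        by (metis (mono_tags, lifting) card.empty mem_Collect_eq mult_zero_right of_nat_0)
      then show "i \<in> card ` Q"
        by blast
    qed
  qed (simp add: assms)
  also have "\<dots> = (\<Sum>i\<in>card ` Q. \<Sum>J\<in>{J \<in> Q. card J = i}. (- 1) ^ card J)"
    by (rule sum.cong) simp_all
  also have "\<dots> = (\<Sum>J\<in>Q. (- 1) ^ card J)"
    by (rule sum.image_gen[OF assms, symmetric])
  finally show ?thesis .
qed

text \<open>Expanding the product selects 1 or the negated monomial from each factor;
  \<open>J\<close> is the set of factors of the second kind.\<close>

lemma lookup_prod_one_minus:
  fixes w :: "'b \<Rightarrow> nat \<Rightarrow>\<^sub>0 nat"
  assumes "finite A"
  shows "Poly_Mapping.lookup (\<Prod>x\<in>A. 1 - Poly_Mapping.single (w x) (1 :: int)) m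
    = (\<Sum>J\<in>{J \<in> Pow A. (\<Sum>x\<in>J. w x) = m}. (- 1) ^ card J)"
proof -
  have single: "(\<Prod>x\<in>J. - Poly_Mapping.single (w x) (1 :: int))
      = Poly_Mapping.single (\<Sum>x\<in>J. w x) ((- 1) ^ card J)" if "finite J" for J
    using that by (induction J rule: finite_induct) (simp_all add: mult_single flip: single_uminus)
  have "(\<Prod>x\<in>A. 1 - Poly_Mapping.single (w x) (1 :: int))
      = (\<Prod>x\<in>A. - Poly_Mapping.single (w x) 1 + 1)"
    by (rule prod.cong) simp_all
  also have "\<dots> = (\<Sum>J\<in>Pow A. \<Prod>x\<in>J. - Poly_Mapping.single (w x) 1)"
    by (simp only: prod_add[OF assms] prod.neutral_const mult_1_right)
  also have "\<dots> = (\<Sum>J\<in>Pow A. Poly_Mapping.single (\<Sum>x\<in>J. w x) ((- 1) ^ card J))"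
    by (rule sum.cong) (use single finite_subset[OF _ assms] in auto)
  finally show ?thesis
    by (simp only: lookup_sum lookup_single when_def sum.inter_filter finite_Pow_iff assms)
qed

lemma keys_sum_nat:
  fixes w :: "'b \<Rightarrow> 'a \<Rightarrow>\<^sub>0 nat"
  shows "finite J \<Longrightarrow> Poly_Mapping.keys (\<Sum>j\<in>J. w j) = (\<Union>j\<in>J. Poly_Mapping.keys (w j))"
  by (induction J rule: finite_induct) (simp_all add: keys_add_nat)

text \<open>Exponents cannot cancel, so a product of monomials involves only the first
  \<open>r\<close> variables exactly if each of its factors does. Hence only subsets of
  \<open>N\<close> contribute, and they give the expansion of the product.\<close>

lemma Phi_alternating_plethysm:
  fixes a :: "nat \<Rightarrow> nat \<Rightarrow>\<^sub>0 nat"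
  assumes "finite N" and N: "\<And>j. j \<in> N \<longleftrightarrow> Poly_Mapping.keys (a j) \<subseteq> {..<r}"
  shows "Phi r (\<lambda>m. Sum_any (\<lambda>i. (- 1) ^ i * subst_series a (elem_sym i) m))
    = Poly_Mapping.lookup (\<Prod>j\<in>N. 1 - Poly_Mapping.single (a j) 1)"
proof
  fix m
  let ?Q = "{J \<in> Pow N. (\<Sum>j\<in>J. a j) = m}"
  have fin: "finite J" if "J \<in> Pow N" for J
    using that assms(1) finite_subset by auto
  show "Phi r (\<lambda>m. Sum_any (\<lambda>i. (- 1) ^ i * subst_series a (elem_sym i) m)) m
    = Poly_Mapping.lookup (\<Prod>j\<in>N. 1 - Poly_Mapping.single (a j) 1) m"
  proof (cases "Poly_Mapping.keys m \<subseteq> {..<r}")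
    case True
    have "J \<in> Pow N" if "finite J" "(\<Sum>j\<in>J. a j) = m" for J
      using keys_sum_nat[OF that(1), of a] that(2) True N by blast
    then have Q: "{J. finite J \<and> card J = i \<and> (\<Sum>j\<in>J. a j) = m} = {J \<in> ?Q. card J = i}" for i
      using fin by auto
    have "finite ?Q"
      using assms(1) by simp
    from Sum_any_card[OF this] True show ?thesis
      by (simp only: Phi_def subst_elem_sym Q lookup_prod_one_minus[OF assms(1)] if_True)
  next
    case False
    have "(\<Sum>j\<in>J. a j) \<noteq> m" if "J \<in> Pow N" for J
      using keys_sum_nat[OF fin[OF that], of a] that N False by blast
    then have "?Q = {}"
      by blast
    with False show ?thesis
      by (simp only: Phi_def lookup_prod_one_minus[OF assms(1)] if_False sum.empty)
  qed
qed

section \<open>Comparison of the two ranks\<close>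

text \<open>Together with \<open>infinite_hall_trees\<close> this lets the Hall trees of one degree
  be enumerated by the natural numbers.\<close>

instance tree :: countable
  by countable_datatype

lemma bij_betw_fiber:
  assumes "bij_betw f A B" and "\<And>x. x \<in> A \<Longrightarrow> g (f x) = h x"
  shows "bij_betw f {x \<in> A. h x = v} {y \<in> B. g y = v}"
proof -
  have "f ` {x \<in> A. h x = v} = {y \<in> f ` A. g y = v}"
    using assms(2) by auto
  with assms(1) show ?thesis
    unfolding bij_betw_def by (auto intro: inj_on_subset)
qed

text \<open>\<open>enumerates_monomials\<close> asks for a sequence indexed by all natural numbers,
  hence for infinitely many trees. The brackets [X_1, [X_1, ... [X_1, X_j]]] with j > 1 provide
  them: every left factor is the least generator, so the Hall condition holds.\<close>

lemma (in hall_order) infinite_hall_trees: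
  assumes "\<And>i j. i < j \<Longrightarrow> lt (Leaf i) (Leaf j)" and "1 \<le> k"
  shows "infinite {t. hall_tree UNIV t \<and> deg t = k}"
proof -
  \<comment> \<open>\<open>comb n j\<close> has \<open>n + 1\<close> leaves, which is why
    \<open>k - 1\<close> appears below.\<close>
  define comb where "comb n j = (Node (Leaf 0) ^^ n) (Leaf j)" for n j
  have "hall_tree UNIV (comb n j) \<and> deg (comb n j) = Suc n \<and> lt (Leaf 0) (comb n j) \<and>
    (\<forall>u v. comb n j = Node u v \<longrightarrow> u = Leaf 0)" if "0 < j" for n j
  proof (induction n)
    case 0
    show ?case
      using assms(1)[OF that] by (simp add: comb_def)
  next
    case (Suc n)
    then show ?case
      using irrefl deg_less[of "Leaf 0" "Node (Leaf 0) (comb n j)"] by (auto simp: comb_def)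
  qed
  then have "comb (k - 1) ` {0<..} \<subseteq> {t. hall_tree UNIV t \<and> deg t = k}"
    using assms(2) by auto
  moreover have "inj (comb n)" for n
    by (induction n) (auto simp: comb_def inj_def)
  then have "infinite (comb (k - 1) ` {0<..})"
    by (meson finite_imageD infinite_Ioi inj_on_subset subset_UNIV)
  ultimately show ?thesis
    using finite_subset by blast
qed

theorem theorem3p11:
  fixes k :: nat
    and Hinf :: "nat \<Rightarrow> nat free_lie set" and leinf :: "nat free_lie rel"
  assumes "k \<ge> 1"
    and "hall_set UNIV Hinf leinf"
  shows "\<forall>r\<ge>2. \<forall>H le. hall_set {..<r} H le \<longrightarrow>
    Phi r (hall_f Hinf leinf k) = Poly_Mapping.lookup (hall_poly H le k)"
proof (intro allI impI)
  fix r H le assume H: "hall_set {..<r} H le"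
  obtain lt where lt: "hall_order lt" "\<And>i j. i < j \<Longrightarrow> lt (Leaf i) (Leaf j)"
    and Hinf: "bij_betw lie_val {t. hall_order.hall_tree lt UNIV t \<and> deg t = k} (Hinf k)"
    and eta_inf: "\<And>t. hall_order.hall_tree lt UNIV t \<Longrightarrow> eta Hinf leinf (lie_val t) = mdeg t"
    using hall_set_trees[OF assms(2)] assms(1) by (metis UNIV_I)
  obtain lt' where lt': "hall_order lt'"
    and Hr: "bij_betw lie_val {t. hall_order.hall_tree lt' {..<r} t \<and> deg t = k} (H k)"
    and eta_r: "\<And>t. hall_order.hall_tree lt' {..<r} t \<Longrightarrow> eta H le (lie_val t) = mdeg t"
    using hall_set_trees[OF H] assms(1) by metis
  interpret L: hall_order lt by fact
  interpret L': hall_order lt' by fact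
  let ?T = "{t. L.hall_tree UNIV t \<and> deg t = k}" and ?T' = "{t. L'.hall_tree {..<r} t \<and> deg t = k}"
  let ?g = "eta Hinf leinf"
  \<comment> \<open>The plethysm uses this unspecified enumeration. Once some enumeration is known
    to exist, the argument uses only how often \<open>a\<close> takes each value.\<close>
  define a where "a = (SOME a. enumerates_monomials a (hall_F Hinf leinf k))"
  have fiber: "bij_betw lie_val {t \<in> ?T. mdeg t = v} {X \<in> Hinf k. ?g X = v}" for v
    by (rule bij_betw_fiber[OF Hinf]) (simp add: eta_inf)
  have finite_T: "finite {t \<in> ?T. mdeg t = v}" for v
    by (rule finite_subset[OF _ L.finite_hall_trees_mdeg[of UNIV v]]) auto
  \<comment> \<open>The multidegrees along an enumeration of the Hall trees of degree
    \<open>k\<close> enumerate the monomials of \<open>hall_F\<close>, which justifies the choice of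
    \<open>a\<close>.\<close>
  have "\<exists>b :: nat \<Rightarrow> tree. bij_betw b UNIV ?T"
    using bij_betw_from_nat_into[OF _ L.infinite_hall_trees[OF lt(2) assms(1)]] by blast
  then obtain b :: "nat \<Rightarrow> tree" where b: "bij_betw b UNIV ?T"
    by blast
  have fiber_b: "bij_betw b {i. mdeg (b i) = v} {t \<in> ?T. mdeg t = v}" for v
    using bij_betw_fiber[OF b refl, of mdeg v] by simp
  have "enumerates_monomials (\<lambda>i. mdeg (b i)) (hall_F Hinf leinf k)"
    unfolding enumerates_monomials_def hall_F_def monomial_sum_def
    using bij_betw_finite[OF fiber_b] finite_T bij_betw_same_card[OF fiber_b] bij_betw_same_card[OF fiber]
    by simp
  then have "enumerates_monomials a (hall_F Hinf leinf k)"
    unfolding a_def by (rule someI[of "\<lambda>a. enumerates_monomials a (hall_F Hinf leinf k)"])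
  then have fin_a: "finite {i. a i = v}" and "hall_F Hinf leinf k v = monomial_sum a UNIV v" for v
    by (simp_all add: enumerates_monomials_def)
  then have card_a: "card {i. a i = v} = card {t \<in> ?T. mdeg t = v}" for v
    using bij_betw_same_card[OF fiber[of v]] by (simp add: hall_F_def monomial_sum_def)
  let ?N = "{j. Poly_Mapping.keys (a j) \<subseteq> {..<r}}"
  \<comment> \<open>If \<open>v\<close> has degree \<open>k\<close> and involves only the first
    \<open>r\<close> variables, the two ranks have equally many Hall trees of multidegree
    \<open>v\<close>. For every other \<open>v\<close> both fibers are empty.\<close>
  have card_N: "card {j \<in> ?N. a j = v} = card {t \<in> ?T'. mdeg t = v}" for v
  proof (cases "Poly_Mapping.keys v \<subseteq> {..<r} \<and> total_degree v = k")
    case True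
    then have "{j \<in> ?N. a j = v} = {j. a j = v}"
      and "{t \<in> ?T. mdeg t = v} = {t. L.hall_tree UNIV t \<and> mdeg t = v}"
      and "{t \<in> ?T'. mdeg t = v} = {t. L'.hall_tree {..<r} t \<and> mdeg t = v}"
      by auto
    with True show ?thesis
      using card_a[of v] card_hall_trees_indep[OF lt(1) lt', of v UNIV "{..<r}"] by simp
  next
    case False
    have "Poly_Mapping.keys v \<subseteq> {..<r} \<and> total_degree v = k" if "t \<in> ?T'" "mdeg t = v" for t
      using that(1) L'.hall_tree_leaves[of "{..<r}" t] by (simp add: keys_mdeg flip: that(2))
    with False have "{t \<in> ?T'. mdeg t = v} = {}"
      by blast
    moreover have "{j \<in> ?N. a j = v} = {}"
    proof (cases "Poly_Mapping.keys v \<subseteq> {..<r}")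
      case True
      with False have "{t \<in> ?T. mdeg t = v} = {}"
        by auto
      \<comment> \<open>An infinite set also has \<open>card\<close> 0, so finiteness is needed to
        conclude emptiness.\<close>
      with card_a[of v] fin_a[of v] have "{i. a i = v} = {}"
        by (metis card.empty card_0_eq)
      then show ?thesis
        by blast
    qed auto
    ultimately show ?thesis
      by (simp only: card.empty)
  qed
  have fin_N: "finite {j \<in> ?N. a j = v}" for v
    using fin_a[of v] by (rule rev_finite_subset) blast
  have fin_T': "finite {t \<in> ?T'. mdeg t = v}" for v
    by (rule finite_subset[OF _ L'.finite_hall_trees_mdeg[of "{..<r}" v]]) auto
  obtain \<beta> where \<beta>: "bij_betw \<beta> ?N ?T'" "\<And>j. j \<in> ?N \<Longrightarrow> mdeg (\<beta> j) = a j"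
    using fiberwise_bij[OF fin_N fin_T' card_N] by blast
  have "finite ?T'"
    by (rule finite_subset[OF _ L'.finite_hall_trees[of "{..<r}" k]]) auto
  then have "finite ?N"
    using bij_betw_finite[OF \<beta>(1)] by simp
  then have "Phi r (hall_f Hinf leinf k)
    = Poly_Mapping.lookup (\<Prod>j\<in>?N. 1 - Poly_Mapping.single (a j) 1)"
    unfolding hall_f_def plethysm_def a_def[symmetric]
    by (rule Phi_alternating_plethysm) simp
  also have "(\<Prod>j\<in>?N. 1 - Poly_Mapping.single (a j) (1 :: int))
      = (\<Prod>j\<in>?N. 1 - Poly_Mapping.single (mdeg (\<beta> j)) 1)"
    by (rule prod.cong) (simp_all add: \<beta>(2))
  also have "\<dots> = (\<Prod>t\<in>?T'. 1 - Poly_Mapping.single (mdeg t) 1)"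
    by (rule prod.reindex_bij_betw[OF \<beta>(1)])
  also have "\<dots> = (\<Prod>t\<in>?T'. 1 - Poly_Mapping.single (eta H le (lie_val t)) 1)"
    by (rule prod.cong) (simp_all add: eta_r)
  also have "\<dots> = hall_poly H le k"
    unfolding hall_poly_def by (rule prod.reindex_bij_betw[OF Hr])
  finally show "Phi r (hall_f Hinf leinf k) = Poly_Mapping.lookup (hall_poly H le k)" .
qed

end
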